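(* Every quasi-Sturmian word $\mathbf{s}$ satisfies $\mathrm{rep}(\mathbf{s})\le\sqrt{10}-\frac32$.
   Context: For an infinite word $\mathbf{x}$ over a finite alphabet, $p(n,\mathbf{x})$ denotes the number of distinct factors of length $n$. A quasi-Sturmian word is an infinite word $\mathbf{x}$ over a finite alphabet for which there exist integers $k$ and $n_0$ with $p(n,\mathbf{x})=n+k$ for all $n\ge n_0$. With $x_i^j=x_i\cdots x_j$, let $r(n,\mathbf{x})=\min\{m\ge1:\ x_i^{i+n-1}=x_{m-n+1}^{m}\text{ for some } 1\le i\le m-n\}$, and $\mathrm{rep}(\mathbf{x})=\liminf_{n\to\infty} r(n,\mathbf{x})/n$. *)

theory Defs
  imports "HOL-Library.Liminf_Limsup" "HOL-Library.Extended_Real" Complex_Main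
begin

(* Infinite words x = x_1 x_2 ... are represented 0-based: x_{i+1} = w i, w :: nat => 'a.
   The alphabet is finite: finite (range w). *)

definition factor :: "(nat \<Rightarrow> 'a) \<Rightarrow> nat \<Rightarrow> nat \<Rightarrow> 'a list" where
  "factor w i n = map (\<lambda>k. w (i + k)) [0..<n]"

definition complexity :: "nat \<Rightarrow> (nat \<Rightarrow> 'a) \<Rightarrow> nat" where
  "complexity n w = card {factor w i n | i. True}"

definition quasi_sturmian :: "(nat \<Rightarrow> 'a) \<Rightarrow> bool" where
  "quasi_sturmian w \<longleftrightarrow> finite (range w) \<and>
     (\<exists>(k::int) n0. \<forall>n\<ge>n0. int (complexity n w) = int n + k)"

(* r(n,x) = min{m >= 1 : x_i^{i+n-1} = x_{m-n+1}^m for some 1 <= i <= m-n}.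
   In 0-based indexing: the factor starting at j = i-1 (0 <= j < m-n) equals the
   factor starting at m-n. *)
definition rec_fun :: "nat \<Rightarrow> (nat \<Rightarrow> 'a) \<Rightarrow> nat" where
  "rec_fun n w = (LEAST m. m \<ge> 1 \<and> n < m \<and>
      (\<exists>j. j < m - n \<and> factor w j n = factor w (m - n) n))"

definition rep :: "(nat \<Rightarrow> 'a) \<Rightarrow> ereal" where
  "rep w = liminf (\<lambda>n. ereal (real (rec_fun n w) / real n))"

end

theory Submission
  imports Defs
begin

text \<open>
  A suitable tail \<open>x\<close> of a quasi-Sturmian word is recurrent and has exactly one right special
  factor of each large length, with two continuations. Every long bispecial factor \<open>B\<close> then has two
  return words, of lengths \<open>P\<close> and \<open>Q\<close> with \<open>|B| - P - Q\<close> constant, and the prefix of \<open>x\<close>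
  before the first occurrence \<open>w\<close> of \<open>B\<close> is a suffix of one of them, say of that of length \<open>P\<close>.
  Passing to the next bispecial factor changes \<open>(P, Q, w)\<close> by one of three linear moves
  \<^item> \<open>a: (P, P + Q, w)\<close>,
  \<^item> \<open>b: (P + Q, P, w + Q)\<close>,
  \<^item> \<open>c: (P + Q, Q, w)\<close>,

  and each of them exhibits explicit early repetitions in \<open>x\<close>. If all of these were too short,
  linear inequalities would exclude every sequence of moves that is not eventually \<open>(cbbb)\<^sup>\<omega>\<close>;
  on that one \<open>P / Q\<close> converges to \<open>sqrt 10 / 2\<close> and the last \<open>b\<close> of each period yields
  exactly the bound \<open>sqrt 10 - 3 / 2\<close>.
\<close>

section \<open>Factors and complexity\<close>

text \<open>Comparing positions instead of lists turns cutting and gluing of factors into arithmetic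
  on offsets, by \<open>agree_add\<close>.\<close>

definition agree :: "(nat \<Rightarrow> 'a) \<Rightarrow> nat \<Rightarrow> nat \<Rightarrow> nat \<Rightarrow> bool" where
  "agree x n i j \<longleftrightarrow> (\<forall>k<n. x (i + k) = x (j + k))"

lemma factor_eq_iff: "factor x i n = factor x j n \<longleftrightarrow> agree x n i j"
  by (auto simp: factor_def agree_def)

lemma agree_refl [simp]: "agree x n i i"
  by (simp add: agree_def)

lemma agree_sym: "agree x n i j \<Longrightarrow> agree x n j i"
  by (simp add: agree_def)

lemma agree_trans: "agree x n i j \<Longrightarrow> agree x n j k \<Longrightarrow> agree x n i k"
  by (simp add: agree_def)

lemma agree_mono: "agree x n i j \<Longrightarrow> m \<le> n \<Longrightarrow> agree x m i j"
  by (simp add: agree_def)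

lemma agree_add: "agree x (m + n) i j \<longleftrightarrow> agree x m i j \<and> agree x n (i + m) (j + m)"
proof -
  have "x (i + k) = x (j + k)"
    if "agree x m i j" "agree x n (i + m) (j + m)" "k < m + n" for k
  proof (cases "k < m")
    case False
    then have "k - m < n" using that(3) by simp
    then have "x (i + m + (k - m)) = x (j + m + (k - m))"
      using that(2) unfolding agree_def by blast
    then show ?thesis using False by simp
  qed (use that in \<open>simp add: agree_def\<close>)
  then show ?thesis
    by (auto simp: agree_def add.assoc)
qed

lemma agree_Suc: "agree x (Suc n) i j \<longleftrightarrow> agree x n i j \<and> x (i + n) = x (j + n)"
  using less_Suc_eq by (auto simp: agree_def)

lemma agree_shift: "agree (\<lambda>k. x (m + k)) n i j \<longleftrightarrow> agree x n (m + i) (m + j)"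
  by (simp add: agree_def add.assoc)

lemma agree_letter: "agree x n i j \<Longrightarrow> k < n \<Longrightarrow> x (i + k) = x (j + k)"
  by (simp add: agree_def)

definition factors :: "(nat \<Rightarrow> 'a) \<Rightarrow> nat \<Rightarrow> 'a list set" where
  "factors x n = range (\<lambda>i. factor x i n)"

lemma complexity_factors: "complexity n x = card (factors x n)"
  by (simp add: complexity_def factors_def full_SetCompr_eq)

lemma finite_factors:
  assumes "finite (range x)"
  shows "finite (factors x n)"
proof (rule finite_subset)
  show "factors x n \<subseteq> {xs. set xs \<subseteq> range x \<and> length xs = n}"
    by (auto simp: factors_def factor_def)
  show "finite {xs. set xs \<subseteq> range x \<and> length xs = n}"
    using finite_lists_length_eq[OF assms] by simp
qed

lemma take_factor: "take n (factor x i (Suc n)) = factor x i n"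
  by (simp add: factor_def)

lemma tl_factor: "tl (factor x i (Suc n)) = factor x (Suc i) n"
  by (rule nth_equalityI) (auto simp: factor_def nth_tl simp del: upt_Suc)

lemma take_factors: "take n ` factors x (Suc n) = factors x n"
  by (simp add: factors_def image_image take_factor)

section \<open>Aperiodicity and strict growth for words of complexity \<open>n + k\<close>\<close>

definition eventual_complexity :: "(nat \<Rightarrow> 'a) \<Rightarrow> int \<Rightarrow> bool" where
  "eventual_complexity x k \<longleftrightarrow> finite (range x) \<and>
     (\<exists>n0. \<forall>n\<ge>n0. int (complexity n x) = int n + k)"

text \<open>From position \<open>i\<close> on the word has period \<open>j - i\<close>, so a
  starting position at or beyond \<open>j\<close> can be moved back by this period until it lies
  below \<open>j\<close>.\<close>

lemma eventually_periodic_complexity_le: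
  assumes "i < j" "\<And>n. agree x n i j"
  shows "complexity n x \<le> j"
proof -
  have "\<exists>l<j. factor x k n = factor x l n" for k
  proof (induction k rule: less_induct)
    case (less k)
    show ?case
    proof (cases "k < j")
      case False
      have "agree x ((k - j) + n) i j" by (rule assms)
      then have "agree x n (i + (k - j)) (j + (k - j))"
        unfolding agree_add by blast
      moreover have "i + (k - j) = k - (j - i)" "j + (k - j) = k"
        using False assms(1) by simp_all
      ultimately have "agree x n (k - (j - i)) k" by simp
      moreover have "k - (j - i) < k" using False assms(1) by simp
      ultimately show ?thesis using less.IH by (metis factor_eq_iff)
    qed auto
  qed
  then have "factors x n \<subseteq> (\<lambda>l. factor x l n) ` {..<j}"
    unfolding factors_def by fastforce
  then have "card (factors x n) \<le> card ((\<lambda>l. factor x l n) ` {..<j})"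
    by (intro card_mono) auto
  also have "\<dots> \<le> j"
    using card_image_le[of "{..<j}" "\<lambda>l. factor x l n"] by simp
  finally show ?thesis by (simp add: complexity_factors)
qed

lemma complexity_unbounded:
  assumes "eventual_complexity x k"
  shows "\<exists>n. complexity n x > m"
proof -
  obtain n0 where n0: "\<And>n. n \<ge> n0 \<Longrightarrow> int (complexity n x) = int n + k"
    using assms by (auto simp: eventual_complexity_def)
  have "int (complexity (n0 + m + 1 + nat (-k)) x) > int m"
    by (subst n0) auto
  then show ?thesis using of_nat_less_iff by blast
qed

lemma not_agree_always:
  assumes "eventual_complexity x k" "i < j"
  shows "\<exists>n. \<not> agree x n i j"
  using complexity_unbounded[OF assms(1), of j] eventually_periodic_complexity_le[OF assms(2)]
  by (meson not_less)

text \<open>Morse and Hedlund: if truncation is injective at some length, the word is eventually periodic.\<close>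

lemma complexity_less_Suc:
  assumes "eventual_complexity x k"
  shows "complexity n x < complexity (Suc n) x"
proof (rule ccontr)
  have fin: "finite (factors x m)" for m
    using assms finite_factors by (auto simp: eventual_complexity_def)
  assume "\<not> ?thesis"
  then have "card (take n ` factors x (Suc n)) = card (factors x (Suc n))"
    using card_image_le[OF fin, of "take n" "Suc n"] take_factors[of n x]
    by (simp add: complexity_factors)
  then have inj: "inj_on (take n) (factors x (Suc n))"
    using fin eq_card_imp_inj_on by blast
  \<comment> \<open>Injective truncation means that a factor of length \<open>n\<close> determines
    its next letter.\<close>
  have step: "agree x (Suc n) i j" if "agree x n i j" for i j
  proof -
    have "factor x i (Suc n) = factor x j (Suc n)"
      by (rule inj_onD[OF inj]) (use that in \<open>auto simp: take_factor factor_eq_iff factors_def\<close>)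
    then show ?thesis by (simp add: factor_eq_iff)
  qed
  have steps: "agree x (n + m) i j" if "agree x n i j" for i j m
    using that
  proof (induction m arbitrary: i j)
    case (Suc m)
    have 1: "agree x (1 + n) i j" using step[OF Suc.prems] by simp
    then have "agree x (n + m) (i + 1) (j + 1)" "agree x 1 i j"
      using Suc.IH by (simp_all only: agree_add)
    then have "agree x (1 + (n + m)) i j" by (simp only: agree_add)
    then show ?case by simp
  qed simp
  have "\<not> inj (\<lambda>i. factor x i n)"
    using fin[of n] by (metis factors_def finite_imageD infinite_UNIV_nat)
  then obtain i j where "i \<noteq> j" "agree x n i j"
    by (auto simp: inj_on_def factor_eq_iff)
  then obtain i j where ij: "i < j" "agree x n i j"
    using agree_sym by (metis linorder_neqE_nat)
  then have "agree x m i j" for m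
    using steps[of i j m] by (simp add: agree_mono)
  then show False using not_agree_always[OF assms ij(1)] by blast
qed

lemma complexity_ge:
  assumes "eventual_complexity x k"
  shows "n \<le> complexity n x"
proof (induction n)
  case (Suc n)
  then show ?case using complexity_less_Suc[OF assms, of n] by simp
qed simp

lemma eventual_complexity_nonneg:
  assumes "eventual_complexity x k"
  shows "0 \<le> k"
proof -
  obtain n0 where "int (complexity n0 x) = int n0 + k"
    using assms by (auto simp: eventual_complexity_def)
  then show ?thesis using complexity_ge[OF assms, of n0] by linarith
qed

section \<open>Deleting initial letters and reaching a recurrent tail\<close>

lemma factors_shift:
  "factors x n = insert (factor x 0 n) (factors (\<lambda>i. x (Suc i)) n)"
proof -
  have "factor (\<lambda>i. x (Suc i)) i n = factor x (Suc i) n" for i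
    by (simp add: factor_def)
  then show ?thesis
    unfolding factors_def by (auto simp: image_iff) (metis not0_implies_Suc)
qed

lemma factor_0_in_shift:
  "factor x 0 n \<in> factors (\<lambda>i. x (Suc i)) n \<longleftrightarrow> (\<exists>j>0. agree x n 0 j)"
proof -
  have "factor (\<lambda>i. x (Suc i)) i n = factor x (Suc i) n" for i
    by (simp add: factor_def)
  then show ?thesis
    by (auto simp: factors_def image_iff factor_eq_iff gr0_conv_Suc)
qed

text \<open>Deleting the first letter can lose only the prefix of each length. Once a prefix never
  recurs, no longer prefix does either, so either nothing is lost at any length or exactly one
  factor at every large length.\<close>

lemma eventual_complexity_shift:
  assumes "eventual_complexity x k"
  obtains "eventual_complexity (\<lambda>i. x (Suc i)) k" "\<And>n. \<exists>j>0. agree x n 0 j"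
  | "eventual_complexity (\<lambda>i. x (Suc i)) (k - 1)"
proof -
  let ?y = "\<lambda>i. x (Suc i)"
  have fin: "finite (range ?y)"
    using assms by (auto simp: eventual_complexity_def intro: finite_subset[of _ "range x"])
  obtain n0 where n0: "\<And>n. n \<ge> n0 \<Longrightarrow> int (complexity n x) = int n + k"
    using assms by (auto simp: eventual_complexity_def)
  show thesis
  proof (cases "\<forall>n. \<exists>j>0. agree x n 0 j")
    case True
    then have "factors x n = factors ?y n" for n
      using factors_shift[of x n] factor_0_in_shift[of x n] by auto
    then have "eventual_complexity ?y k"
      using n0 fin by (auto simp: eventual_complexity_def complexity_factors)
    then show ?thesis using True that(1) by blast
  next
    case False
    then obtain m where m: "\<not> (\<exists>j>0. agree x m 0 j)" by blast
    have "int (complexity n ?y) = int n + (k - 1)" if n: "n \<ge> max n0 m" for n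
    proof -
      have "\<not> (\<exists>j>0. agree x n 0 j)"
        using m n agree_mono[of x n 0 _ m] by (metis max.boundedE)
      then have "factor x 0 n \<notin> factors ?y n"
        using factor_0_in_shift by blast
      then have "card (factors x n) = Suc (card (factors ?y n))"
        using factors_shift[of x n] finite_factors[OF fin] by simp
      then show ?thesis using n0[of n] n by (simp add: complexity_factors)
    qed
    then have "eventual_complexity ?y (k - 1)"
      using fin unfolding eventual_complexity_def by blast
    then show ?thesis by (rule that(2))
  qed
qed

text \<open>Induction on \<open>k\<close>, which cannot become negative. Letters before the first
  non-recurrent position \<open>i\<close> can be deleted without changing \<open>k\<close>; deleting
  the letter at \<open>i\<close> lowers \<open>k\<close> by one.\<close>

lemma recurrent_shift_exists:
  assumes "eventual_complexity x k"
  shows "\<exists>m k'. eventual_complexity (\<lambda>i. x (m + i)) k' \<and>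
           (\<forall>n i K. \<exists>j\<ge>K. agree (\<lambda>i. x (m + i)) n i j)"
  using assms
proof (induction "nat k" arbitrary: x k rule: less_induct)
  case less
  have ex: "\<exists>m. eventual_complexity (\<lambda>i. x (m + i)) (k - 1)"
    if nrec: "\<exists>i n. \<forall>j>i. \<not> agree x n i j"
  proof -
    define i where "i = (LEAST i. \<exists>n. \<forall>j>i. \<not> agree x n i j)"
    have i: "\<exists>n. \<forall>j>i. \<not> agree x n i j"
      unfolding i_def using LeastI_ex[OF nrec] .
    have rec: "\<exists>j>l. agree x n l j" if "l < i" for l n
      using not_less_Least that unfolding i_def by blast
    have "eventual_complexity (\<lambda>j. x (l + j)) k" if "l \<le> i" for l
      using that
    proof (induction l)
      case (Suc l)
      then have ec: "eventual_complexity (\<lambda>j. x (l + j)) k" by simp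
      show ?case
      proof (cases rule: eventual_complexity_shift[OF ec])
        \<comment> \<open>Position \<open>l\<close> is recurrent, so the shift keeps all factors and
          its complexity cannot be smaller by one.\<close>
        case 2
        let ?y = "\<lambda>j. x (l + j)"
        have eq: "factors ?y n = factors (\<lambda>i. ?y (Suc i)) n" for n
        proof -
          obtain j where "j > l" "agree x n l j" using rec[of l n] Suc.prems by auto
          then have "\<exists>j>0. agree ?y n 0 j"
            by (intro exI[of _ "j - l"]) (simp add: agree_shift)
          then show ?thesis
            using factors_shift[of ?y n] factor_0_in_shift[of ?y n] by auto
        qed
        obtain n1 n2 where
          "\<And>n. n \<ge> n1 \<Longrightarrow> int (complexity n ?y) = int n + k"
          "\<And>n. n \<ge> n2 \<Longrightarrow> int (complexity n (\<lambda>i. ?y (Suc i))) = int n + (k - 1)"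
          using ec 2 by (auto simp: eventual_complexity_def)
        from this(1)[of "max n1 n2"] this(2)[of "max n1 n2"] show ?thesis
          by (simp add: complexity_factors eq)
      qed simp
    qed (use less.prems in simp)
    then have ec: "eventual_complexity (\<lambda>j. x (i + j)) k" by simp
    show ?thesis
    proof (cases rule: eventual_complexity_shift[OF ec])
      case 1
      obtain n where n: "\<And>j. j > i \<Longrightarrow> \<not> agree x n i j" using i by blast
      obtain j where "j > 0" "agree x n i (i + j)" using 1(2)[of n] by (auto simp: agree_shift)
      then show ?thesis using n[of "i + j"] by simp
    next
      case 2
      then show ?thesis by (intro exI[of _ "Suc i"]) simp
    qed
  qed
  show ?case
  proof (cases "\<exists>i n. \<forall>j>i. \<not> agree x n i j")
    case True
    then obtain m where m: "eventual_complexity (\<lambda>i. x (m + i)) (k - 1)"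
      using ex by blast
    have "0 \<le> k - 1" by (rule eventual_complexity_nonneg[OF m])
    then have "nat (k - 1) < nat k" by simp
    from less.hyps[OF this m] obtain m' k' where
      "eventual_complexity (\<lambda>i. x (m + (m' + i))) k'"
      "\<forall>n i K. \<exists>j\<ge>K. agree (\<lambda>i. x (m + (m' + i))) n i j"
      by blast
    then show ?thesis by (intro exI[of _ "m + m'"] exI[of _ k']) (simp add: add.assoc)
  next
    case False
    have "\<exists>j\<ge>K. agree x n i j" for n i K
    proof (induction K)
      case (Suc K)
      then obtain j where j: "j \<ge> K" "agree x n i j" by blast
      obtain l where "l > j" "agree x n j l" using False by blast
      then show ?case using j agree_trans by (metis Suc_leI le_less_trans)
    qed (use agree_refl in blast)
    then show ?thesis using less.prems by (intro exI[of _ 0] exI[of _ k]) simp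
  qed
qed


section \<open>Return words of bispecial factors\<close>

text \<open>\<open>X\<close> has just one element more than its image, so removing either of
  \<open>u\<close> and \<open>v\<close> makes \<open>f\<close> injective; any collision must
  therefore involve both.\<close>

lemma collision_unique:
  assumes "finite X" "card X = Suc (card (f ` X))"
    and "u \<in> X" "v \<in> X" "u \<noteq> v" "f u = f v"
    and "u' \<in> X" "v' \<in> X" "u' \<noteq> v'" "f u' = f v'"
  shows "{u', v'} = {u, v}"
proof -
  have inj: "inj_on f (X - {u})"
    if "u \<in> X" "v \<in> X" "u \<noteq> v" "f u = f v" for u v
  proof (rule eq_card_imp_inj_on)
    have "f ` (X - {u}) = f ` X" using that by (auto simp: image_iff)
    then show "card (f ` (X - {u})) = card (X - {u})"
      using assms(1,2) that(1) by simp
  qed (use assms(1) in simp)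
  have "u \<in> {u', v'}" using inj_onD[OF inj[OF assms(3-6)], of u' v'] assms(7-10) by blast
  moreover have "v \<in> {u', v'}"
    using inj_onD[OF inj[of v u], of u' v'] assms(3-10) by auto
  ultimately show ?thesis using assms(5) by auto
qed

locale recurrent_unit_growth =
  fixes x :: "nat \<Rightarrow> 'a" and n0 :: nat
  assumes finite_alphabet: "finite (range x)"
    and recurrent: "\<exists>j\<ge>K. agree x n i j"
    and growth: "n \<ge> n0 \<Longrightarrow> complexity (Suc n) x = Suc (complexity n x)"
    and aperiodic: "i < j \<Longrightarrow> \<exists>n. \<not> agree x n i j"
begin

section \<open>Special and bispecial factors\<close>

lemma right_special_exists:
  assumes "n \<ge> n0"
  shows "\<exists>i j. agree x n i j \<and> x (i + n) \<noteq> x (j + n)"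
proof (rule ccontr)
  assume "\<not> ?thesis"
  then have "inj_on (take n) (factors x (Suc n))"
    by (auto simp: inj_on_def factors_def take_factor factor_eq_iff agree_Suc)
  then have "card (factors x n) = card (factors x (Suc n))"
    using take_factors[of n x] card_image by metis
  then show False using growth[OF assms] by (simp add: complexity_factors)
qed

text \<open>Two right special situations are two collisions of truncation on factors of length
  \<open>n + 1\<close>, and by counting there is only one such pair of factors.\<close>

lemma right_special_collision:
  assumes "n \<ge> n0"
    and "agree x n i j" "x (i + n) \<noteq> x (j + n)"
    and "agree x n i' j'" "x (i' + n) \<noteq> x (j' + n)"
  shows "agree x (Suc n) i i' \<or> agree x (Suc n) i j'"
proof -
  let ?f = "\<lambda>i. factor x i (Suc n)"
  have "{?f i', ?f j'} = {?f i, ?f j}"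
  proof (rule collision_unique[where f = "take n" and X = "factors x (Suc n)"])
    show "card (factors x (Suc n)) = Suc (card (take n ` factors x (Suc n)))"
      using growth[OF assms(1)] by (simp add: complexity_factors take_factors)
    show "finite (factors x (Suc n))"
      by (rule finite_factors[OF finite_alphabet])
  qed (use assms(2-) in \<open>auto simp: factors_def take_factor factor_eq_iff agree_Suc\<close>)
  then have "?f i = ?f i' \<or> ?f i = ?f j'" by (auto simp: doubleton_eq_iff)
  then show ?thesis by (simp add: factor_eq_iff)
qed

lemma right_special_unique:
  assumes "n \<ge> n0"
    and "agree x n i j" "x (i + n) \<noteq> x (j + n)"
    and "agree x n i' j'" "x (i' + n) \<noteq> x (j' + n)"
  shows "agree x n i i'"
  using right_special_collision[OF assms] assms(4)
  by (meson agree_Suc agree_sym agree_trans)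

lemma right_special_two_letters:
  assumes "n \<ge> n0" "agree x n i j" "agree x n i l" "x (i + n) \<noteq> x (j + n)"
  shows "x (l + n) = x (i + n) \<or> x (l + n) = x (j + n)"
proof (rule ccontr)
  assume *: "\<not> ?thesis"
  have "agree x n j l" using assms agree_sym agree_trans by metis
  then show False
    using right_special_collision[OF assms(1,2,4), of j l] * assms(4)
    by (auto simp: agree_Suc)
qed

text \<open>Deleting first letters maps the factors of length \<open>n + 1\<close> into those of
  length \<open>n\<close>, which are fewer by one, so two of the former share their tail.\<close>

lemma left_special_exists:
  assumes "n \<ge> n0"
  shows "\<exists>i j. agree x n (Suc i) (Suc j) \<and> x i \<noteq> x j"
proof (rule ccontr)
  assume neg: "\<not> ?thesis"
  have "inj_on tl (factors x (Suc n))"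
  proof (rule inj_onI)
    fix f g assume "f \<in> factors x (Suc n)" "g \<in> factors x (Suc n)" and tl: "tl f = tl g"
    then obtain i j where fg: "f = factor x i (Suc n)" "g = factor x j (Suc n)"
      by (auto simp: factors_def)
    then have "agree x n (Suc i) (Suc j)"
      using tl by (simp add: tl_factor factor_eq_iff)
    moreover from this have "x i = x j" using neg by blast
    ultimately have "agree x (1 + n) i j" unfolding agree_add by (simp add: agree_def)
    then show "f = g" by (simp add: fg factor_eq_iff)
  qed
  then have "card (factors x (Suc n)) = card (tl ` factors x (Suc n))"
    by (simp add: card_image)
  also have "\<dots> \<le> card (factors x n)"
    by (intro card_mono finite_factors finite_alphabet) (auto simp: factors_def tl_factor)
  finally show False using growth[OF assms] by (simp add: complexity_factors)
qed

text \<open>A left special factor of length \<open>n0\<close> is prolonged to the right until its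
  two occurrences first disagree; aperiodicity guarantees that this happens.\<close>

lemma bispecial_exists:
  shows "\<exists>i j b. b \<ge> n0 \<and> agree x b (Suc i) (Suc j) \<and> x i \<noteq> x j \<and>
           x (Suc i + b) \<noteq> x (Suc j + b)"
proof -
  obtain i j where ij: "agree x n0 (Suc i) (Suc j)" "x i \<noteq> x j"
    using left_special_exists[of n0] by auto
  have "\<exists>n. \<not> agree x n (Suc i) (Suc j)"
    using aperiodic[of "Suc i" "Suc j"] aperiodic[of "Suc j" "Suc i"] ij(2) agree_sym
    by (metis Suc_less_eq linorder_neqE_nat)
  then obtain n where n: "\<not> agree x n (Suc i) (Suc j)" "\<And>m. m < n \<Longrightarrow> agree x m (Suc i) (Suc j)"
    using exists_least_iff[of "\<lambda>n. \<not> agree x n (Suc i) (Suc j)"] by blast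
  have "n0 < n" using n(1) ij(1) agree_mono by (metis not_less)
  then obtain b where b: "n = Suc b" "b \<ge> n0" by (cases n) auto
  then show ?thesis using n ij(2) by (auto simp: agree_Suc)
qed

text \<open>
  \<open>A \<union> D\<close> is the set of occurrences of a bispecial factor of length \<open>b\<close>; the occurrences in \<open>A\<close>
  (in \<open>D\<close>) are continued by a return word of length \<open>P\<close> (of length \<open>Q\<close>), and \<open>w\<close> is the first
  occurrence.
\<close>

definition returns :: "nat \<Rightarrow> nat \<Rightarrow> nat \<Rightarrow> nat set \<Rightarrow> nat set \<Rightarrow> nat \<Rightarrow> bool" where
  "returns b P Q A D w \<longleftrightarrow> b \<ge> n0 \<and> 0 < P \<and> 0 < Q \<and> A \<noteq> {} \<and> D \<noteq> {} \<and> w \<in> A \<union> D \<and>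
     (\<forall>i\<in>A \<union> D. \<forall>j. agree x b i j \<longleftrightarrow> j \<in> A \<union> D) \<and>
     (\<forall>i\<in>A. \<forall>j\<in>A. agree x (b + P) i j) \<and>
     (\<forall>i\<in>D. \<forall>j\<in>D. agree x (b + Q) i j) \<and>
     (\<forall>i\<in>A. \<forall>j\<in>D. x (i + b) \<noteq> x (j + b)) \<and>
     (\<forall>i\<in>A. i + P \<in> A \<union> D) \<and> (\<forall>i\<in>D. i + Q \<in> A \<union> D) \<and>
     (\<forall>i\<in>A. \<forall>j\<in>D. x (i + P - 1) \<noteq> x (j + Q - 1)) \<and>
     (\<forall>k\<in>A \<union> D. k = w \<or> (\<exists>i\<in>A. k = i + P) \<or> (\<exists>i\<in>D. k = i + Q))"

text \<open>The prefix of length \<open>w\<close> is a suffix of the return word of length \<open>P\<close>.\<close>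

definition suffix_of_return :: "nat \<Rightarrow> nat \<Rightarrow> nat set \<Rightarrow> nat \<Rightarrow> bool" where
  "suffix_of_return b P A w \<longleftrightarrow> w \<le> P \<and> (\<forall>i\<in>A. agree x (w + b) (i + P - w) 0)"

lemma returns_swap: "returns b P Q A D w \<Longrightarrow> returns b Q P D A w"
  unfolding returns_def by (simp add: Un_commute) metis


lemma returnsD:
  assumes "returns b P Q A D w"
  shows "b \<ge> n0" "0 < P" "0 < Q" "A \<noteq> {}" "D \<noteq> {}" "w \<in> A \<union> D"
    and "i \<in> A \<union> D \<Longrightarrow> agree x b i j \<longleftrightarrow> j \<in> A \<union> D"
    and "i \<in> A \<Longrightarrow> j \<in> A \<Longrightarrow> agree x (b + P) i j"
    and "i \<in> D \<Longrightarrow> j \<in> D \<Longrightarrow> agree x (b + Q) i j"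
    and "i \<in> A \<Longrightarrow> j \<in> D \<Longrightarrow> x (i + b) \<noteq> x (j + b)"
    and "i \<in> A \<Longrightarrow> i + P \<in> A \<union> D"
    and "i \<in> D \<Longrightarrow> i + Q \<in> A \<union> D"
    and "i \<in> A \<Longrightarrow> j \<in> D \<Longrightarrow> x (i + P - 1) \<noteq> x (j + Q - 1)"
    and "k \<in> A \<union> D \<Longrightarrow> k = w \<or> (\<exists>i\<in>A. k = i + P) \<or> (\<exists>i\<in>D. k = i + Q)"
  using assms unfolding returns_def by blast+

text \<open>One occurrence suffices: all occurrences in \<open>A\<close> begin the same
  \<open>b + P\<close> letters, and \<open>w <= P\<close> keeps the compared window inside
  them.\<close>

lemma suffix_of_returnI:
  assumes "i \<in> A" "\<And>j. j \<in> A \<Longrightarrow> agree x (b + P) i j" "w \<le> P" "agree x (w + b) (i + P - w) 0"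
  shows "suffix_of_return b P A w"
  unfolding suffix_of_return_def
proof (intro conjI ballI)
  fix j assume "j \<in> A"
  then have "agree x (P - w + (w + b)) i j" using assms(2,3) by (simp add: add.commute)
  then have "agree x (w + b) (i + (P - w)) (j + (P - w))" unfolding agree_add[of _ "P - w"] by blast
  then have "agree x (w + b) (i + P - w) (j + P - w)" using assms(3) by simp
  then show "agree x (w + b) (j + P - w) 0" using assms(4) agree_sym agree_trans by blast
qed (rule assms(3))

text \<open>The occurrences of a bispecial factor are sorted into \<open>A\<close> and
  \<open>D\<close> by their next letter; that letter alone determines the path to the next
  occurrence.\<close>

lemma returns_initial:
  "\<exists>b P Q A D w. returns b P Q A D w \<and> suffix_of_return b P A w"
proof -
  obtain i0 j0 b where b: "b \<ge> n0" and ag0: "agree x b (Suc i0) (Suc j0)"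
    and left: "x i0 \<noteq> x j0" and right: "x (Suc i0 + b) \<noteq> x (Suc j0 + b)"
    using bispecial_exists by blast
  define U where "U = {k. agree x b (Suc i0) k}"
  define A where "A = {k\<in>U. x (k + b) = x (Suc i0 + b)}"
  define D where "D = {k\<in>U. x (k + b) = x (Suc j0 + b)}"
  have U: "U = A \<union> D"
    using right_special_two_letters[OF b ag0 _ right] by (auto simp: A_def D_def U_def)
  have U_agree: "agree x b i j \<longleftrightarrow> j \<in> U" if "i \<in> U" for i j
    using that agree_sym agree_trans unfolding U_def by blast
  have i0A: "Suc i0 \<in> A" and j0D: "Suc j0 \<in> D" using ag0 by (auto simp: A_def D_def U_def)
  define gap where "gap k = (LEAST g. 0 < g \<and> k + g \<in> U)" for k
  have gap: "0 < gap k" "k + gap k \<in> U" if "k \<in> U" for k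
  proof -
    obtain j where "j \<ge> Suc k" "agree x b k j" using recurrent by blast
    then have "0 < j - k \<and> k + (j - k) \<in> U" using U_agree[OF that] by simp
    from LeastI[of "\<lambda>g. 0 < g \<and> k + g \<in> U", OF this] show "0 < gap k" "k + gap k \<in> U"
      unfolding gap_def by auto
  qed
  have gap_le: "gap k \<le> g" if "0 < g" "k + g \<in> U" for k g
    unfolding gap_def using that by (intro Least_le) simp
  \<comment> \<open>Strictly between consecutive occurrences no factor of length \<open>b\<close> is
    right special, since the only right special one is the bispecial factor itself; so the
    continuation is forced.\<close>
  have forced: "agree x (b + m) i j"
    if "i \<in> U" "agree x (Suc b) i j" "0 < m" "m \<le> gap i" for i j m
    using that(3,4)
  proof (induction m)
    case (Suc m)
    show ?case
    proof (cases "m = 0")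
      case False
      then have IH: "agree x (b + m) i j" using Suc by simp
      then have ag: "agree x b (i + m) (j + m)"
        unfolding add.commute[of b] agree_add by blast
      have "i + m \<notin> U" using gap_le[of m i] False Suc.prems by auto
      then have "x (i + m + b) = x (j + m + b)"
        using right_special_unique[OF b ag0 right ag] U_def by blast
      then show ?thesis using IH by (simp add: agree_Suc ac_simps)
    qed (use that(2) in simp)
  qed simp
  have same: "gap j = gap i \<and> agree x (b + gap i) i j"
    if "i \<in> U" "j \<in> U" "x (i + b) = x (j + b)" for i j
  proof -
    have *: "gap j \<le> gap i \<and> agree x (b + gap i) i j"
      if "i \<in> U" "j \<in> U" "x (i + b) = x (j + b)" for i j
    proof -
      have ag: "agree x (b + gap i) i j"
        using forced[of i j "gap i"] that U_agree gap by (simp add: agree_Suc)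
      then have "agree x b (i + gap i) (j + gap i)"
        unfolding add.commute[of b] agree_add by blast
      then have "j + gap i \<in> U" using U_agree gap(2) that(1) by blast
      then show ?thesis using ag gap_le gap(1) that(1) by blast
    qed
    show ?thesis using *[OF that] *[of j i] that by auto
  qed
  define P where "P = gap (Suc i0)"
  define Q where "Q = gap (Suc j0)"
  have AU: "i \<in> U" "gap i = P" if "i \<in> A" for i
    using same[of "Suc i0" i] i0A that by (auto simp: A_def P_def)
  have DU: "i \<in> U" "gap i = Q" if "i \<in> D" for i
    using same[of "Suc j0" i] j0D that by (auto simp: D_def Q_def)
  have PQ: "0 < P" "0 < Q" unfolding P_def Q_def using gap(1) i0A j0D AU(1) DU(1) by blast+
  have agA: "agree x (b + P) i j" if "i \<in> A" "j \<in> A" for i j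
  proof -
    have "x (i + b) = x (j + b)" using that by (simp add: A_def)
    then show ?thesis using same[OF AU(1)[OF that(1)] AU(1)[OF that(2)]] AU(2)[OF that(1)] by simp
  qed
  have agD: "agree x (b + Q) i j" if "i \<in> D" "j \<in> D" for i j
  proof -
    have "x (i + b) = x (j + b)" using that by (simp add: D_def)
    then show ?thesis using same[OF DU(1)[OF that(1)] DU(1)[OF that(2)]] DU(2)[OF that(1)] by simp
  qed
  define w where "w = (LEAST k. k \<in> U)"
  have wU: "w \<in> U" unfolding w_def using i0A AU by (metis LeastI)
  have w_le: "w \<le> k" if "k \<in> U" for k unfolding w_def using that by (rule Least_le)
  have pred: "\<exists>i\<in>U. k = i + gap i" if k: "k \<in> U" "k \<noteq> w" for k
  proof -
    define M where "M = {i\<in>U. i < k}"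
    have "w \<in> M" using w_le[OF k(1)] k(2) wU by (auto simp: M_def)
    moreover have "finite M" by (simp add: M_def)
    ultimately have mx: "Max M \<in> M" "\<And>i. i \<in> M \<Longrightarrow> i \<le> Max M"
      by (metis Max_in Max_ge empty_iff)+
    define i where "i = Max M"
    have i: "i \<in> U" "i < k" using mx(1) by (auto simp: M_def i_def)
    have "gap i \<le> k - i" using gap_le[of "k - i" i] i k by simp
    moreover have "\<not> i + gap i < k"
      using mx(2)[of "i + gap i"] gap[OF i(1)] by (auto simp: M_def i_def)
    ultimately show ?thesis using i by (intro bexI[of _ i]) auto
  qed
  have pred': "k = w \<or> (\<exists>i\<in>A. k = i + P) \<or> (\<exists>i\<in>D. k = i + Q)" if k: "k \<in> U" for k
  proof (cases "k = w")
    case False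
    then obtain i where "i \<in> A \<union> D" "k = i + gap i" using pred[OF k] U by blast
    then show ?thesis using AU(2) DU(2) by fastforce
  qed simp
  \<comment> \<open>Equal last letters would give every occurrence after \<open>w\<close> the same
    preceding letter, and by recurrence every occurrence that has a preceding letter, contradicting
    left speciality.\<close>
  have last: "x (i + P - 1) \<noteq> x (j + Q - 1)" if i: "i \<in> A" and j: "j \<in> D" for i j
  proof
    assume eq: "x (i + P - 1) = x (j + Q - 1)"
    have const: "x (k - 1) = x (i + P - 1)" if k: "k \<in> U" "k \<noteq> w" for k
      using pred'[OF k(1)] k(2)
    proof (elim disjE bexE)
      fix i' assume "i' \<in> A" "k = i' + P"
      then show ?thesis using agree_letter[OF agA[of i' i], of "P - 1"] i PQ by simp
    next
      fix j' assume "j' \<in> D" "k = j' + Q"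
      then show ?thesis using agree_letter[OF agD[of j' j], of "Q - 1"] j PQ eq by simp
    qed simp
    have "x l = x (i + P - 1)" if "Suc l \<in> U" for l
    proof -
      obtain k where k: "k \<ge> w" "agree x (1 + b) l k" using recurrent by blast
      then have "agree x b (Suc l) (Suc k)" "x l = x k"
        unfolding agree_add by (auto simp: agree_def)
      then have "Suc k \<in> U" using U_agree that by blast
      then show ?thesis using const[of "Suc k"] k(1) \<open>x l = x k\<close> by simp
    qed
    then show False using left AU(1)[OF i0A] DU(1)[OF j0D] by metis
  qed
  have ret: "returns b P Q A D w"
    unfolding returns_def U[symmetric]
  proof (intro conjI)
    show "b \<ge> n0" "0 < P" "0 < Q" "w \<in> U" using b PQ wU by auto
    show "A \<noteq> {}" "D \<noteq> {}" using i0A j0D by auto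
    show "\<forall>i\<in>U. \<forall>j. agree x b i j \<longleftrightarrow> j \<in> U" using U_agree by blast
    show "\<forall>i\<in>A. \<forall>j\<in>A. agree x (b + P) i j" using agA by blast
    show "\<forall>i\<in>D. \<forall>j\<in>D. agree x (b + Q) i j" using agD by blast
    show "\<forall>i\<in>A. \<forall>j\<in>D. x (i + b) \<noteq> x (j + b)" using right by (simp add: A_def D_def)
    show "\<forall>i\<in>A. i + P \<in> U" using AU gap(2) by metis
    show "\<forall>i\<in>D. i + Q \<in> U" using DU gap(2) by metis
    show "\<forall>i\<in>A. \<forall>j\<in>D. x (i + P - 1) \<noteq> x (j + Q - 1)" using last by blast
    show "\<forall>k\<in>U. k = w \<or> (\<exists>i\<in>A. k = i + P) \<or> (\<exists>i\<in>D. k = i + Q)" using pred' by blast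
  qed
  \<comment> \<open>\<open>k\<close> is a later occurrence of the prefix up to the end of the first
    bispecial factor; \<open>k + w\<close> then ends some return word, starting at
    \<open>i\<close>.\<close>
  obtain k where k: "k \<ge> 1" "agree x (w + b) 0 k" using recurrent by blast
  have "agree x b w (k + w)" using k(2) unfolding agree_add by simp
  then have kw: "k + w \<in> U" using U_agree wU by blast
  then obtain i where i: "i \<in> U" "k + w = i + gap i" using pred[of "k + w"] k(1) by auto
  \<comment> \<open>If \<open>k <= i\<close>, copying back by \<open>k\<close> would put an
    occurrence at \<open>i - k\<close>, before the first one \<open>w\<close>. Hence the prefix of
    length \<open>w\<close> fits inside the return word.\<close>
  have "i < k"
  proof (rule ccontr)
    assume "\<not> i < k"
    then have le: "k \<le> i" "i < k + w" using i gap(1)[OF i(1)] by auto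
    have "agree x ((i - k) + b) 0 k" using k(2) le by (auto intro: agree_mono)
    then have "agree x b (i - k) i" unfolding agree_add using le by simp
    then have "i - k \<in> U" using U_agree i(1) agree_sym by blast
    then show False using w_le[of "i - k"] le by simp
  qed
  then have "w \<le> gap i" "i + gap i - w = k" using i(2) by auto
  then have "suffix_of_return b P A w \<or> suffix_of_return b Q D w"
    using i(1) U AU(2)[of i] DU(2)[of i] agA agD agree_sym[OF k(2)]
      suffix_of_returnI[of i A b P w] suffix_of_returnI[of i D b Q w] by auto
  then show ?thesis using ret returns_swap by blast
qed

section \<open>Passing to the next bispecial factor\<close>

lemma changes_return:
  assumes "returns b P Q A D w"
  shows "\<exists>i\<in>A. i + P \<in> D"
proof (rule ccontr)
  note R = returnsD[OF assms]
  assume "\<not> ?thesis"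
  then have AA: "i + P \<in> A" if "i \<in> A" for i using R(11)[OF that] that by blast
  \<comment> \<open>Staying in \<open>A\<close> forever would make the word eventually periodic with
    period \<open>P\<close>.\<close>
  have "agree x n i (i + P)" if "i \<in> A" for i n
    using that
  proof (induction n arbitrary: i)
    case (Suc n)
    have "agree x P i (i + P)"
      using R(8)[OF Suc.prems AA[OF Suc.prems]] by (rule agree_mono) simp
    moreover have "agree x n (i + P) (i + P + P)" using Suc.IH AA Suc.prems by blast
    ultimately have "agree x (P + n) i (i + P)" by (simp add: agree_add)
    then show ?case using R(2) by (auto intro: agree_mono)
  qed (simp add: agree_def)
  moreover obtain i where "i \<in> A" using R(4) by blast
  ultimately show False using aperiodic[of i "i + P"] R(2) by auto
qed

text \<open>A return word that can follow itself makes the bispecial factor, preceded by the last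
  letter of that return word, right special of length \<open>b + 1\<close>. The two last letters
  differ and exactly one factor of that length is right special, so exactly one return word can be
  repeated.\<close>

lemma isolated_return:
  assumes "returns b P Q A D w"
  shows "(\<exists>i\<in>A. i + P \<in> A) \<longleftrightarrow> \<not> (\<exists>i\<in>D. i + Q \<in> D)"
proof -
  note R = returnsD[OF assms]
  obtain i1 where i1: "i1 \<in> A" "i1 + P \<in> D" using changes_return[OF assms] by blast
  obtain j1 where j1: "j1 \<in> D" "j1 + Q \<in> A"
    using changes_return[OF returns_swap[OF assms]] by blast
  have agP: "agree x (Suc b) (i + P - 1) (j + P - 1)" if "i \<in> A" "j \<in> A" for i j
  proof -
    have "agree x ((P - 1) + Suc b) i j" using R(8)[OF that] R(2) by (simp add: ac_simps)
    then have "agree x (Suc b) (i + (P - 1)) (j + (P - 1))" unfolding agree_add by blast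
    then show ?thesis using R(2) by simp
  qed
  have agQ: "agree x (Suc b) (i + Q - 1) (j + Q - 1)" if "i \<in> D" "j \<in> D" for i j
  proof -
    have "agree x ((Q - 1) + Suc b) i j" using R(9)[OF that] R(3) by (simp add: ac_simps)
    then have "agree x (Suc b) (i + (Q - 1)) (j + (Q - 1))" unfolding agree_add by blast
    then show ?thesis using R(3) by simp
  qed
  have not_both: False if i: "i \<in> A" "i + P \<in> A" and j: "j \<in> D" "j + Q \<in> D" for i j
  proof -
    have "x (i + P - 1 + Suc b) \<noteq> x (i1 + P - 1 + Suc b)"
      using R(10)[OF i(2) i1(2)] R(2) by simp
    moreover have "x (j + Q - 1 + Suc b) \<noteq> x (j1 + Q - 1 + Suc b)"
      using R(10)[OF j1(2) j(2)] R(3) by simp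
    ultimately have "agree x (Suc b) (i + P - 1) (j + Q - 1)"
      using right_special_unique[OF _ agP[OF i(1) i1(1)] _ agQ[OF j(1) j1(1)]] R(1) by simp
    then show False using R(13)[OF i(1) j(1)] agree_letter[of x "Suc b" _ _ 0] by fastforce
  qed
  have not_neither: False
    if nA: "\<And>i. i \<in> A \<Longrightarrow> i + P \<notin> A" and nD: "\<And>i. i \<in> D \<Longrightarrow> i + Q \<notin> D"
  proof -
    obtain i' j' where ij': "agree x (Suc b) i' j'" "x (i' + Suc b) \<noteq> x (j' + Suc b)"
      using right_special_exists[of "Suc b"] R(1) by auto
    \<comment> \<open>Occurrences are moved beyond \<open>w\<close> so that the letter before the
      bispecial factor is the last letter of a return word.\<close>
    obtain i where i: "i \<ge> w" "agree x (Suc (Suc b)) i' i" using recurrent by blast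
    obtain j where j: "j \<ge> w" "agree x (Suc (Suc b)) j' j" using recurrent by blast
    have ij: "agree x (1 + b) i j" "x (Suc i + b) \<noteq> x (Suc j + b)"
      using ij' i(2) j(2) by (auto simp: agree_Suc[of x "Suc b"] intro: agree_sym agree_trans)
    from ij(1) have agb: "agree x b (Suc i) (Suc j)" and xij: "x i = x j"
      unfolding agree_add by (auto simp: agree_def)
    have "agree x b (i1 + P) (j1 + Q)" using R(7)[of "i1 + P" "j1 + Q"] i1 j1 by blast
    moreover have "x (i1 + P + b) \<noteq> x (j1 + Q + b)" using R(10)[OF j1(2) i1(2)] by simp
    ultimately have "agree x b (i1 + P) (Suc i)"
      using right_special_unique[OF R(1) _ _ agb ij(2)] by blast
    then have iU: "Suc i \<in> A \<union> D" using R(7)[of "i1 + P" "Suc i"] i1 by blast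
    then have jU: "Suc j \<in> A \<union> D" using R(7)[OF iU] agb by blast
    have lastA: "x k = x (j1 + Q - 1)" if kA: "Suc k \<in> A" "k \<ge> w" for k
    proof -
      have "Suc k \<noteq> w" "Suc k \<in> A \<union> D" using that by auto
      then obtain l where l: "l \<in> D" "Suc k = l + Q"
        using R(14)[of "Suc k"] kA(1) nA by metis
      then have "x k = x (l + Q - 1)" by (metis diff_Suc_1)
      then show ?thesis using agree_letter[OF agQ[OF l(1) j1(1)], of 0] by simp
    qed
    have lastD: "x k = x (i1 + P - 1)" if kD: "Suc k \<in> D" "k \<ge> w" for k
    proof -
      have "Suc k \<noteq> w" "Suc k \<in> A \<union> D" using that by auto
      then obtain l where l: "l \<in> A" "Suc k = l + P"
        using R(14)[of "Suc k"] kD(1) nD by metis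
      then have "x k = x (l + P - 1)" by (metis diff_Suc_1)
      then show ?thesis using agree_letter[OF agP[OF l(1) i1(1)], of 0] by simp
    qed
    have "\<not> (Suc i \<in> A \<and> Suc j \<in> A)" "\<not> (Suc i \<in> D \<and> Suc j \<in> D)"
      using ij(2) agree_letter[OF R(8), of "Suc i" "Suc j" b] R(2)
        agree_letter[OF R(9), of "Suc i" "Suc j" b] R(3) by auto
    then show False
      using iU jU lastA lastD i(1) j(1) xij R(13)[OF i1(1) j1(1)] by (metis UnE)
  qed
  show ?thesis using not_both not_neither by blast
qed

text \<open>The next bispecial factor is the return word of length \<open>P\<close> followed by the
  old bispecial factor; its occurrences are \<open>A\<close>. As the other return word is never
  repeated, the new return words have lengths \<open>P\<close> and \<open>P + Q\<close>.\<close>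

lemma returns_step:
  assumes "returns b P Q A D w" "\<exists>i\<in>A. i + P \<in> A"
  shows "returns (b + P) P (P + Q) {i\<in>A. i + P \<in> A} {i\<in>A. i + P \<in> D}
           (if w \<in> A then w else w + Q)"
proof -
  note R = returnsD[OF assms(1)]
  have DA: "i + Q \<in> A" if "i \<in> D" for i
    using isolated_return[OF assms(1)] assms(2) R(12)[OF that] that by blast
  have union: "{i\<in>A. i + P \<in> A} \<union> {i\<in>A. i + P \<in> D} = A" using R(11) by blast
  have ag: "agree x (b + P) i j \<longleftrightarrow> j \<in> A" if "i \<in> A" for i j
  proof
    assume ij: "agree x (b + P) i j"
    then have "agree x b i j" by (rule agree_mono) simp
    then have "j \<in> A \<union> D" using R(7) that by blast
    moreover have "x (i + b) = x (j + b)" using agree_letter[OF ij, of b] R(2) by simp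
    ultimately show "j \<in> A" using R(10)[OF that] by blast
  qed (use R(8) that in blast)
  have agA: "agree x (b + P + P) i j" if "i \<in> A" "i + P \<in> A" "j \<in> A" "j + P \<in> A" for i j
  proof -
    have "agree x P i j" using R(8)[OF that(1,3)] by (rule agree_mono) simp
    then have "agree x (P + (b + P)) i j" unfolding agree_add[of _ P] using R(8)[OF that(2,4)] by blast
    then show ?thesis by (simp add: ac_simps)
  qed
  have agD: "agree x (b + P + (P + Q)) i j"
    if "i \<in> A" "i + P \<in> D" "j \<in> A" "j + P \<in> D" for i j
  proof -
    have "agree x P i j" using R(8)[OF that(1,3)] by (rule agree_mono) simp
    moreover have "agree x Q (i + P) (j + P)" using R(9)[OF that(2,4)] by (rule agree_mono) simp
    moreover have "agree x (b + P) (i + P + Q) (j + P + Q)"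
      using R(8) DA that by blast
    ultimately have "agree x (P + (Q + (b + P))) i j"
      unfolding agree_add[of _ P] agree_add[of _ Q] by blast
    then show ?thesis by (simp add: ac_simps)
  qed
  have pred: "k = (if w \<in> A then w else w + Q) \<or> (\<exists>i\<in>{i\<in>A. i + P \<in> A}. k = i + P) \<or>
      (\<exists>i\<in>{i\<in>A. i + P \<in> D}. k = i + (P + Q))" if k: "k \<in> A" for k
  proof -
    consider "k = w" | i where "i \<in> A" "k = i + P" | i where "i \<in> D" "k = i + Q"
      using R(14) k by blast
    then show ?thesis
    proof cases
      \<comment> \<open>An occurrence in \<open>D\<close> is never reached from \<open>D\<close>, so
        the one before it, if any, lies in \<open>A\<close> and the total gap is
        \<open>P + Q\<close>; otherwise it is \<open>w\<close> itself.\<close>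
      case (3 i)
      then have "i = w \<or> (\<exists>j\<in>A. i = j + P)" using R(10,14) DA by blast
      then show ?thesis using 3 R(10)[of w w] by auto
    qed (use k in auto)
  qed
  have last: "x (i + P - 1) \<noteq> x (j + (P + Q) - 1)" if "i \<in> A" "j + P \<in> D" for i j
    using R(13)[OF that] by (simp add: add.assoc)
  have right: "x (i + (b + P)) \<noteq> x (j + (b + P))" if "i + P \<in> A" "j + P \<in> D" for i j
    using R(10)[OF that] by (simp add: ac_simps)
  have nonempty: "{i\<in>A. i + P \<in> A} \<noteq> {}" "{i\<in>A. i + P \<in> D} \<noteq> {}"
    using assms(2) changes_return[OF assms(1)] by auto
  have w': "(if w \<in> A then w else w + Q) \<in> A" using R(6) DA by auto
  have closed: "i + (P + Q) \<in> A" if "i + P \<in> D" for i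
    using DA[OF that] by (simp add: add.assoc)
  show ?thesis
    unfolding returns_def union
  proof (intro conjI)
    show "b + P \<ge> n0" "0 < P" "0 < P + Q" using R(1-3) by auto
    show "\<forall>i\<in>A. \<forall>j. agree x (b + P) i j \<longleftrightarrow> j \<in> A" using ag by blast
    show "\<forall>i\<in>{i\<in>A. i + P \<in> A}. \<forall>j\<in>{i\<in>A. i + P \<in> A}. agree x (b + P + P) i j"
      using agA by blast
    show "\<forall>i\<in>{i\<in>A. i + P \<in> D}. \<forall>j\<in>{i\<in>A. i + P \<in> D}. agree x (b + P + (P + Q)) i j"
      using agD by blast
    show "\<forall>i\<in>{i\<in>A. i + P \<in> A}. \<forall>j\<in>{i\<in>A. i + P \<in> D}. x (i + (b + P)) \<noteq> x (j + (b + P))"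
      using right by blast
    show "\<forall>i\<in>{i\<in>A. i + P \<in> A}. i + P \<in> A" by blast
    show "\<forall>i\<in>{i\<in>A. i + P \<in> D}. i + (P + Q) \<in> A" using closed by blast
    show "\<forall>i\<in>{i\<in>A. i + P \<in> A}. \<forall>j\<in>{i\<in>A. i + P \<in> D}. x (i + P - 1) \<noteq> x (j + (P + Q) - 1)"
      using last by blast
    show "\<forall>k\<in>A. k = (if w \<in> A then w else w + Q) \<or> (\<exists>i\<in>{i\<in>A. i + P \<in> A}. k = i + P) \<or>
        (\<exists>i\<in>{i\<in>A. i + P \<in> D}. k = i + (P + Q))"
      using pred by blast
  qed (use nonempty w' in blast)+
qed

section \<open>The prefix before the first occurrence\<close>

lemma suffix_step_stay:
  assumes "returns b P Q A D w" "suffix_of_return b P A w" "w \<in> A"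
  shows "suffix_of_return (b + P) P {i\<in>A. i + P \<in> A} w"
  unfolding suffix_of_return_def
proof (intro conjI ballI)
  note R = returnsD[OF assms(1)]
  show wP: "w \<le> P" using assms(2) by (simp add: suffix_of_return_def)
  fix i assume i: "i \<in> {i\<in>A. i + P \<in> A}"
  then have "agree x (w + b) (i + P - w) 0" using assms(2) by (simp add: suffix_of_return_def)
  then have "agree x w (i + P - w) 0" by (rule agree_mono) simp
  \<comment> \<open>Both \<open>i + P\<close> and \<open>w\<close> lie in \<open>A\<close>, the
    occurrences of the new bispecial factor, which prolongs the agreement from \<open>b\<close> to
    \<open>b + P\<close> letters.\<close>
  moreover have "agree x (b + P) (i + P - w + w) (0 + w)" using R(8)[of "i + P" w] i wP assms(3) by simp
  ultimately show "agree x (w + (b + P)) (i + P - w) 0" unfolding agree_add[of _ w] by blast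
qed

text \<open>The return word of length \<open>P\<close> closes the new longer one. It is never
  repeated, hence leads back into \<open>D\<close>, where \<open>w\<close> lies.\<close>

lemma suffix_step_lengthen:
  assumes "returns b P Q A D w" "suffix_of_return b P A w" "w \<in> D" "\<exists>i\<in>D. i + Q \<in> D"
  shows "suffix_of_return (b + Q) (Q + P) {i\<in>D. i + Q \<in> A} w"
  unfolding suffix_of_return_def
proof (intro conjI ballI)
  note R = returnsD[OF assms(1)]
  have wP: "w \<le> P" using assms(2) by (simp add: suffix_of_return_def)
  then show "w \<le> Q + P" by simp
  fix i assume i: "i \<in> {i\<in>D. i + Q \<in> A}"
  then have "agree x (w + b) (i + Q + P - w) 0" using assms(2) by (simp add: suffix_of_return_def)
  then have "agree x w (i + Q + P - w) 0" by (rule agree_mono) simp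
  moreover have "i + Q + P \<in> D"
    using isolated_return[OF assms(1)] assms(4) R(11) i by blast
  then have "agree x (b + Q) (i + Q + P - w + w) (0 + w)"
    using R(9)[of "i + Q + P" w] wP assms(3) by simp
  ultimately have "agree x (w + (b + Q)) (i + Q + P - w) 0" unfolding agree_add[of _ w] by blast
  then show "agree x (w + (b + Q)) (i + (Q + P) - w) 0" by (simp add: add.assoc)
qed

text \<open>The prefix grows by the return word of length \<open>Q\<close> leading from
  \<open>w\<close> into \<open>A\<close>, and the same word closes the new return word of length
  \<open>P + Q\<close>.\<close>

lemma suffix_step_change:
  assumes "returns b P Q A D w" "suffix_of_return b P A w" "w \<in> D" "\<exists>i\<in>A. i + P \<in> A"
  shows "suffix_of_return (b + P) (P + Q) {i\<in>A. i + P \<in> D} (w + Q)"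
  unfolding suffix_of_return_def
proof (intro conjI ballI)
  note R = returnsD[OF assms(1)]
  have wP: "w \<le> P" using assms(2) by (simp add: suffix_of_return_def)
  then show "w + Q \<le> P + Q" by simp
  fix i assume i: "i \<in> {i\<in>A. i + P \<in> D}"
  have DA: "j + Q \<in> A" if "j \<in> D" for j
    using isolated_return[OF assms(1)] assms(4) R(12)[OF that] that by blast
  have "agree x (w + b) (i + P - w) 0" using i assms(2) by (simp add: suffix_of_return_def)
  then have "agree x w (i + P - w) 0" by (rule agree_mono) simp
  moreover have "agree x Q (i + P) w"
    using R(9)[of "i + P" w] i assms(3) by (auto intro: agree_mono)
  then have "agree x Q (i + P - w + w) (0 + w)" using wP by simp
  moreover have "agree x (b + P) (i + P + Q) (w + Q)" using R(8) DA i assms(3) by blast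
  then have "agree x (b + P) (i + P - w + w + Q) (0 + w + Q)" using wP by simp
  ultimately have "agree x (w + (Q + (b + P))) (i + P - w) 0"
    unfolding agree_add[of _ w] agree_add[of _ Q] by blast
  then show "agree x (w + Q + (b + P)) (i + (P + Q) - (w + Q)) 0" using wP by (simp add: ac_simps)
qed

text \<open>A nonempty prefix would end with the last letter of the return word of length
  \<open>P\<close>. A later copy of it leading to \<open>A\<close> must end the other return word,
  because the first is not repeated, and the two last letters differ.\<close>

lemma isolated_head_prefix_empty:
  assumes "returns b P Q A D w" "suffix_of_return b P A w" "w \<in> A" "\<not> (\<exists>i\<in>A. i + P \<in> A)"
  shows "w = 0"
proof (rule ccontr)
  note R = returnsD[OF assms(1)]
  assume w: "w \<noteq> 0"
  \<comment> \<open>The additional letter after the bispecial factor ensures that the copy also lies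
    in \<open>A\<close>.\<close>
  obtain k where k: "k \<ge> 1" "agree x (w + (b + 1)) 0 k" using recurrent by blast
  then have kw: "agree x b w (k + w)" "x (w + b) = x (k + w + b)"
    unfolding agree_add by (auto simp: agree_def)
  then have "k + w \<in> A \<union> D" using R(7) assms(3) by blast
  then have "k + w \<in> A" using R(10)[OF assms(3)] kw(2) by auto
  then obtain j where j: "j \<in> D" "k + w = j + Q"
    using R(14)[of "k + w"] k(1) assms(4) by auto
  have "x (w - 1) = x (k + (w - 1))" using agree_letter[OF k(2), of "w - 1"] w by simp
  also have "k + (w - 1) = j + Q - 1" using j(2) w by simp
  finally have "x (w - 1) = x (j + Q - 1)" .
  moreover have wP: "w \<le> P" and "agree x (w + b) (w + P - w) 0"
    using assms(2,3) by (auto simp: suffix_of_return_def)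
  then have "x (w + P - 1) = x (w - 1)"
    using agree_letter[of x "w + b" "w + P - w" 0 "w - 1"] w by (simp add: ac_simps)
  ultimately show False using R(13)[OF assms(3) j(1)] by simp
qed

section \<open>One step of the itinerary\<close>

definition stage :: "nat \<Rightarrow> nat \<Rightarrow> nat \<Rightarrow> nat \<Rightarrow> bool" where
  "stage b P Q w \<longleftrightarrow> (\<exists>A D. returns b P Q A D w \<and> suffix_of_return b P A w)"

lemma stage_pos: "stage b P Q w \<Longrightarrow> 0 < P \<and> 0 < Q \<and> w \<le> P"
  unfolding stage_def returns_def suffix_of_return_def by blast

text \<open>In the last alternative the prefix is empty, hence a suffix of both return words, and the roles
  of the two are exchanged before move \<open>b\<close>.\<close>

lemma stage_step:
  assumes "stage b P Q w"
  shows "stage (b + P) P (P + Q) w \<and> agree x (w + b) 0 P \<or>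
    stage (b + P) (P + Q) P (w + Q) \<and> agree x b w (w + Q) \<and> agree x (w + b) 0 (P + Q) \<or>
    stage (b + Q) (P + Q) Q w \<and> agree x b w (w + Q) \<or>
    w = 0 \<and> stage (b + Q) (P + Q) Q P"
proof -
  obtain A D where ret: "returns b P Q A D w" and suf: "suffix_of_return b P A w"
    using assms by (auto simp: stage_def)
  note R = returnsD[OF ret]
  have disj: "i \<notin> D" if "i \<in> A" for i using R(10) that by blast
  show ?thesis
  proof (cases "\<exists>i\<in>A. i + P \<in> A")
    case True
    note step = returns_step[OF ret True]
    show ?thesis
    proof (cases "w \<in> A")
      case wA: True
      then have "stage (b + P) P (P + Q) w"
        using step suffix_step_stay[OF ret suf] unfolding stage_def by auto
      moreover have "agree x (w + b) 0 P"
        using suf wA agree_sym by (fastforce simp: suffix_of_return_def)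
      ultimately show ?thesis by blast
    next
      case wA: False
      then have wD: "w \<in> D" using R(6) by blast
      have "stage (b + P) (P + Q) P (w + Q)"
        using returns_swap[OF step] suffix_step_change[OF ret suf wD True] wA
        unfolding stage_def by auto
      moreover have "agree x b w (w + Q)" using R(7,12) wD by blast
      moreover have "w + Q \<in> A"
        using isolated_return[OF ret] True R(12)[OF wD] wD by blast
      \<comment> \<open>Going ahead by \<open>P\<close> and back by \<open>w\<close> from the
        occurrence \<open>w + Q\<close> in \<open>A\<close> leads to \<open>P + Q\<close>.\<close>
      then have "agree x (w + b) 0 (P + Q)"
        using suf agree_sym by (fastforce simp: suffix_of_return_def ac_simps)
      ultimately show ?thesis by blast
    qed
  next
    case False
    then have DD: "\<exists>i\<in>D. i + Q \<in> D" using isolated_return[OF ret] by blast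
    note step = returns_step[OF returns_swap[OF ret] DD]
    show ?thesis
    proof (cases "w \<in> A")
      case wA: True
      then have "w = 0" using isolated_head_prefix_empty[OF ret suf _ False] by blast
      moreover from this have "suffix_of_return b Q D w"
        using R(7) R(12) wA unfolding suffix_of_return_def by auto
      then have "stage (b + Q) (Q + P) Q (w + P)"
        using returns_swap[OF step] suffix_step_change[OF returns_swap[OF ret] _ wA DD] disj[OF wA]
        unfolding stage_def by auto
      ultimately show ?thesis by (simp add: add.commute)
    next
      case wA: False
      then have wD: "w \<in> D" using R(6) by blast
      have "stage (b + Q) (Q + P) Q w"
        using returns_swap[OF step] suffix_step_lengthen[OF ret suf wD DD] wD
        unfolding stage_def by auto
      moreover have "agree x b w (w + Q)" using R(7,12) wD by blast
      ultimately show ?thesis by (simp add: add.commute)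
    qed
  qed
qed

end

section \<open>Itineraries of return lengths\<close>

text \<open>
  The three ways in which \<open>(P, Q, w)\<close> changes at a bispecial factor (see \<open>stage_step\<close>), together
  with the inequalities \<open>\<kappa> L - K \<le> j\<close> that the repetitions available there must satisfy when
  no factor of length \<open>L\<close> has a second occurrence at a position \<open>j < \<kappa> L - K\<close>.
\<close>

definition move_a :: "real \<Rightarrow> real \<Rightarrow> real \<times> real \<times> real \<Rightarrow> real \<times> real \<times> real \<Rightarrow> bool" where
  "move_a \<kappa> K = (\<lambda>(P, Q, w) (P', Q', w'). P' = P \<and> Q' = P + Q \<and> w' = w \<and>
     \<kappa> * (w + P + Q) - K \<le> P)"

definition move_b :: "real \<Rightarrow> real \<Rightarrow> real \<times> real \<times> real \<Rightarrow> real \<times> real \<times> real \<Rightarrow> bool" where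
  "move_b \<kappa> K = (\<lambda>(P, Q, w) (P', Q', w'). P' = P + Q \<and> Q' = P \<and> w' = w + Q \<and>
     \<kappa> * (P + Q) - K \<le> w + Q \<and> \<kappa> * (w + P + Q) - K \<le> P + Q)"

definition move_c :: "real \<Rightarrow> real \<Rightarrow> real \<times> real \<times> real \<Rightarrow> real \<times> real \<times> real \<Rightarrow> bool" where
  "move_c \<kappa> K = (\<lambda>(P, Q, w) (P', Q', w'). P' = P + Q \<and> Q' = Q \<and> w' = w \<and>
     \<kappa> * (P + Q) - K \<le> w + Q)"

text \<open>After \<open>bbc\<close> the exclusions force \<open>bbbc\<close>, which ends in
  \<open>bbc\<close> again, so the pattern perpetuates itself. A first \<open>bbc\<close> is found
  because a block of \<open>b\<close> following a \<open>c\<close> has two or three letters.\<close>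

lemma eventually_cbbb:
  fixes B C :: "nat \<Rightarrow> bool"
  assumes BC: "\<And>t. B t \<or> C t"
    and C_not_forever: "\<And>t. \<exists>s\<ge>t. \<not> C s"
    and bbbb: "\<And>t. \<not> (B t \<and> B (t + 1) \<and> B (t + 2) \<and> B (t + 3))"
    and cbc: "\<And>t. \<not> (C t \<and> B (t + 1) \<and> C (t + 2))"
    and bbcc: "\<And>t. \<not> (B t \<and> B (t + 1) \<and> C (t + 2) \<and> C (t + 3))"
    and bbcbbc: "\<And>t. \<not> (B t \<and> B (t + 1) \<and> C (t + 2) \<and> B (t + 3) \<and> B (t + 4) \<and> C (t + 5))"
  shows "\<exists>s. \<forall>n. C (s + 4 * n) \<and> B (s + 4 * n + 1) \<and> B (s + 4 * n + 2) \<and> B (s + 4 * n + 3)"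
proof -
  obtain t where t: "C t" using BC bbbb by blast
  define s where "s = (LEAST s. s \<ge> t \<and> \<not> C s)"
  have s: "s \<ge> t" "\<not> C s"
    unfolding s_def using LeastI_ex[OF C_not_forever[of t, unfolded Bex_def]] by auto
  have "s \<noteq> t" using s(2) t by auto
  then have "t < s" using s(1) by simp
  then obtain k where "s = Suc (t + k)" using less_imp_Suc_add by blast
  then obtain r where r: "s = r + 1" "r \<ge> t" by (intro that[of "t + k"]) auto
  have "C r" using not_less_Least[of r "\<lambda>s. s \<ge> t \<and> \<not> C s"] r unfolding s_def[symmetric] by auto
  moreover have "B (r + 1)" using s(2) r BC by auto
  ultimately have r2: "B (r + 2)" using cbc BC by blast
  have "\<exists>u. B u \<and> B (u + 1) \<and> C (u + 2)"
  proof (cases "C (r + 3)")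
    case True
    then show ?thesis using \<open>B (r + 1)\<close> r2 by (intro exI[of _ "r + 1"]) (simp add: numeral_eq_Suc)
  next
    case False
    then have "B (r + 3)" using BC by blast
    moreover have "C (r + 4)"
      using bbbb[of "r + 1"] BC \<open>B (r + 1)\<close> r2 \<open>B (r + 3)\<close> by (simp add: numeral_eq_Suc) blast
    ultimately show ?thesis using r2 by (intro exI[of _ "r + 2"]) (simp add: numeral_eq_Suc)
  qed
  then obtain u where u: "B u" "B (u + 1)" "C (u + 2)" by blast
  have block: "B (v + 3) \<and> B (v + 4) \<and> B (v + 5) \<and> C (v + 6)"
    if v: "B v" "B (v + 1)" "C (v + 2)" for v
  proof -
    have 3: "B (v + 3)" using bbcc v BC by blast
    have 4: "B (v + 4)" using cbc[of "v + 2"] v 3 BC[of "v + 4"] by (simp add: numeral_eq_Suc)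
    have 5: "B (v + 5)" using bbcbbc v 3 4 BC by blast
    have "C (v + 6)" using bbbb[of "v + 3"] 3 4 5 BC[of "v + 6"] by (simp add: numeral_eq_Suc)
    then show ?thesis using 3 4 5 by blast
  qed
  have "B (u + 4 * n) \<and> B (u + 4 * n + 1) \<and> C (u + 4 * n + 2)" for n
  proof (induction n)
    case (Suc n)
    then show ?case using block[of "u + 4 * n"] by (simp add: numeral_eq_Suc)
  qed (use u in simp)
  then have "C (u + 2 + 4 * n) \<and> B (u + 2 + 4 * n + 1) \<and> B (u + 2 + 4 * n + 2) \<and>
      B (u + 2 + 4 * n + 3)" for n
    using block[of "u + 4 * n"] by (simp add: numeral_eq_Suc)
  then show ?thesis by blast
qed

text \<open>The sums \<open>P + Q\<close> are unbounded, so the constant \<open>K\<close> becomes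
  negligible and only the slope \<kappa> matters.\<close>

lemma no_itinerary:
  fixes P Q w :: "nat \<Rightarrow> real"
  assumes \<kappa>: "\<kappa> > sqrt 10 - 5 / 2"
    and P: "\<And>t. P t \<ge> 1" and Q: "\<And>t. Q t \<ge> 1" and w: "\<And>t. 0 \<le> w t" "\<And>t. w t \<le> P t"
    and step: "\<And>t. move_a \<kappa> K (P t, Q t, w t) (P (Suc t), Q (Suc t), w (Suc t)) \<or>
      move_b \<kappa> K (P t, Q t, w t) (P (Suc t), Q (Suc t), w (Suc t)) \<or>
      move_c \<kappa> K (P t, Q t, w t) (P (Suc t), Q (Suc t), w (Suc t)) \<or>
      w t = 0 \<and> P (Suc t) = P t + Q t \<and> Q (Suc t) = Q t \<and> w (Suc t) = P t"
  shows False
proof -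
  define S where "S t = (P t, Q t, w t)" for t
  \<comment> \<open>3.162 - 2.5 = 331/500, which leaves room above the rounded value 33/50.\<close>
  have "sqrt 10 > 3162 / 1000" by (rule real_less_rsqrt) (simp add: power2_eq_square)
  then have \<kappa>1: "\<kappa> > 331 / 500" using \<kappa> by simp
  have grow: "P t + Q t \<ge> real t" for t
  proof (induction t)
    case 0
    show ?case using P[of 0] Q[of 0] by simp
  next
    case (Suc t)
    then show ?case using step[of t] P[of t] Q[of t]
      by (auto simp: move_a_def move_b_def move_c_def)
  qed
  have w_mono: "w (Suc t) \<ge> w t" for t
    using step[of t] P[of t] Q[of t] by (auto simp: move_a_def move_b_def move_c_def)
  \<comment> \<open>The fourth alternative makes \<open>w\<close> positive, and \<open>w\<close>
    never decreases, so it can occur only once.\<close>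
  have "\<exists>t0. \<forall>t\<ge>t0. \<not> (w t = 0 \<and> w (Suc t) = P t)"
  proof (cases "\<exists>t. w t > 0")
    case True
    then obtain t0 where "w t0 > 0" by blast
    then have "w t > 0" if "t \<ge> t0" for t
      using that lift_Suc_mono_le[of w, OF w_mono] less_le_trans by blast
    then show ?thesis by (metis less_irrefl)
  next
    case False
    then show ?thesis using P by (metis less_le_trans zero_less_one)
  qed
  then obtain t0 where t0: "\<And>t. t \<ge> t0 \<Longrightarrow> \<not> (w t = 0 \<and> w (Suc t) = P t)" by blast
  \<comment> \<open>Rounding \<open>sqrt 10 - 5 / 2 = 0.66227...\<close>
    down to \<open>33 / 50\<close> absorbs \<open>K\<close> and still excludes all itineraries but \<open>(cbbb)\<^sup>\<omega>\<close>.\<close>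
  define t1 where "t1 = max t0 (nat \<lceil>\<bar>K\<bar> / (\<kappa> - 33 / 50)\<rceil>)"
  have slack: "33 / 50 * X \<le> \<kappa> * X - K" if "t \<ge> t1" "X \<ge> P t + Q t" for t X
  proof -
    have "\<bar>K\<bar> / (\<kappa> - 33 / 50) \<le> real (nat \<lceil>\<bar>K\<bar> / (\<kappa> - 33 / 50)\<rceil>)" by (rule real_nat_ceiling_ge)
    also have "\<dots> \<le> t" using that(1) by (simp add: t1_def)
    also have "\<dots> \<le> X" using grow[of t] that(2) by simp
    finally have "\<bar>K\<bar> \<le> (\<kappa> - 33 / 50) * X" using \<kappa>1 by (simp add: field_simps)
    then show ?thesis by (simp add: algebra_simps)
  qed
  define a where "a t = move_a (33 / 50) 0 (S t) (S (Suc t))" for t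
  \<comment> \<open>No rounding here: the sharp inequality of the last \<open>b\<close> of a period
    enters the final estimate.\<close>
  define B where "B t = move_b \<kappa> K (S t) (S (Suc t))" for t
  define C where "C t = move_c \<kappa> K (S t) (S (Suc t))" for t
  note mdefs = move_a_def move_b_def move_c_def S_def
  have aBC: "a t \<or> B t \<or> C t" if "t \<ge> t1" for t
    using step[of t] t0[of t] that slack[OF that, of "w t + P t + Q t"] w(1)[of t]
    by (auto simp: a_def B_def C_def mdefs t1_def)
  have a: "P (Suc t) = P t" "Q (Suc t) = P t + Q t" "w (Suc t) = w t"
    "33 * w t + 33 * P t + 33 * Q t \<le> 50 * P t" if "a t" for t
    using that by (auto simp: a_def mdefs)
  have B: "P (Suc t) = P t + Q t" "Q (Suc t) = P t" "w (Suc t) = w t + Q t"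
    "33 * P t + 33 * Q t \<le> 50 * w t + 50 * Q t" "33 * w t + 33 * P t + 33 * Q t \<le> 50 * P t + 50 * Q t"
    if "B t" "t \<ge> t1" for t
    using that(1) slack[OF that(2), of "w t + P t + Q t"] slack[OF that(2), of "P t + Q t"] w(1)[of t]
    by (auto simp: B_def mdefs)
  have C: "P (Suc t) = P t + Q t" "Q (Suc t) = Q t" "w (Suc t) = w t"
    "33 * P t + 33 * Q t \<le> 50 * w t + 50 * Q t"
    if "C t" "t \<ge> t1" for t
    using that(1) slack[OF that(2), of "P t + Q t"] w(1)[of t]
    by (auto simp: C_def mdefs)
  \<comment> \<open>After \<open>a\<close> or \<open>b\<close> the inequality of the second move
    \<open>a\<close> fails outright; after \<open>c\<close> it contradicts the inequality of
    \<open>c\<close>.\<close>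
  have no_a: "\<not> a (Suc t)" if t: "t \<ge> t1" for t
  proof
    assume "a (Suc t)"
    note a' = a[OF this]
    from aBC[OF t] show False
    proof (elim disjE)
      assume "a t"
      from a[OF this] show False using a' w(1)[of t] P[of t] Q[of t] by linarith
    next
      assume "B t"
      from B[OF this t] show False using a' w(1)[of t] P[of t] Q[of t] by linarith
    next
      assume "C t"
      from C[OF this t] show False using a' w(1)[of t] P[of t] Q[of t] by linarith
    qed
  qed
  define T where "T = Suc t1"
  have BC: "B t \<or> C t" if "t \<ge> T" for t
    using aBC[of t] no_a[of "t - 1"] that by (cases t) (auto simp: T_def)
  have T1: "t \<ge> t1" if "t \<ge> T" for t using that by (simp add: T_def)
  \<comment> \<open>Common to \<open>b\<close> and \<open>c\<close>, so it is available at the stage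
    after an excluded pattern although the move there is unknown.\<close>
  have BCw: "33 * P t + 33 * Q t \<le> 50 * w t + 50 * Q t" if "t \<ge> T" for t
    using BC[OF that] B(4) C(4) T1[OF that] by blast
  have "\<exists>s. \<forall>n. C (T + (s + 4 * n)) \<and> B (T + (s + 4 * n + 1)) \<and> B (T + (s + 4 * n + 2)) \<and>
      B (T + (s + 4 * n + 3))"
  proof (rule eventually_cbbb[of "\<lambda>t. B (T + t)" "\<lambda>t. C (T + t)"])
    show "B (T + t) \<or> C (T + t)" for t using BC by simp
  next
    fix t
    show "\<exists>s\<ge>t. \<not> C (T + s)"
    proof (rule ccontr)
      assume "\<not> ?thesis"
      then have Cs: "C (T + t + n)" for n by (auto simp: add.assoc)
      \<comment> \<open>Repeated \<open>c\<close> keeps \<open>Q\<close> and \<open>w\<close> and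
        lets \<open>P\<close> grow linearly, which eventually violates \<open>BCw\<close>.\<close>
      have it: "P (T + t + n) = P (T + t) + n * Q (T + t) \<and> Q (T + t + n) = Q (T + t) \<and>
        w (T + t + n) = w (T + t)" for n
      proof (induction n)
        case (Suc n)
        then show ?case using C[OF Cs[of n]] T1[of "T + t + n"] by (simp add: algebra_simps)
      qed simp
      obtain n :: nat where n: "real n > 2 * w (T + t) + 2 * Q (T + t)" using reals_Archimedean2 by blast
      have "33 * (n * Q (T + t)) + 33 * P (T + t) + 33 * Q (T + t) \<le> 50 * w (T + t) + 50 * Q (T + t)"
        using BCw[of "T + t + n"] it[of n] by simp
      moreover have "real n \<le> n * Q (T + t)" using Q[of "T + t"] by (simp add: mult_le_cancel_left1)
      ultimately show False using n P[of "T + t"] Q[of "T + t"] w(1)[of "T + t"] by linarith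
    qed
  next
    fix t
    define u where "u = T + t"
    have u: "u \<ge> T" "u \<ge> t1" "Suc u \<ge> t1" "Suc (Suc u) \<ge> t1" "Suc (Suc (Suc u)) \<ge> t1"
      "Suc (Suc (Suc (Suc u))) \<ge> t1" "Suc (Suc (Suc (Suc (Suc u)))) \<ge> t1"
      by (auto simp: u_def T_def)
    have uT: "Suc u \<ge> T" "Suc (Suc u) \<ge> T" "Suc (Suc (Suc u)) \<ge> T" "Suc (Suc (Suc (Suc u))) \<ge> T" "Suc (Suc (Suc (Suc (Suc u)))) \<ge> T" "Suc (Suc (Suc (Suc (Suc (Suc u))))) \<ge> T"
      by (auto simp: u_def)
    have eqs: "T + t = u" "T + (t + 1) = Suc u" "T + (t + 2) = Suc (Suc u)"
      "T + (t + 3) = Suc (Suc (Suc u))" "T + (t + 4) = Suc (Suc (Suc (Suc u)))"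
      "T + (t + 5) = Suc (Suc (Suc (Suc (Suc u))))"
      by (auto simp: u_def)
    note pos = P[of u] Q[of u] w[of u]
    show "\<not> (B (T + t) \<and> B (T + (t + 1)) \<and> B (T + (t + 2)) \<and> B (T + (t + 3)))"
    proof
      assume "B (T + t) \<and> B (T + (t + 1)) \<and> B (T + (t + 2)) \<and> B (T + (t + 3))"
      then have "B u" "B (Suc u)" "B (Suc (Suc u))" "B (Suc (Suc (Suc u)))" unfolding eqs by blast+
      from B[OF this(1) u(2)] B[OF this(2) u(3)] B[OF this(3) u(4)] B[OF this(4) u(5)] BCw[OF uT(4)] pos
      show False by linarith
    qed
    show "\<not> (C (T + t) \<and> B (T + (t + 1)) \<and> C (T + (t + 2)))"
    proof
      assume "C (T + t) \<and> B (T + (t + 1)) \<and> C (T + (t + 2))"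
      then have "C u" "B (Suc u)" "C (Suc (Suc u))" unfolding eqs by blast+
      from C[OF this(1) u(2)] B[OF this(2) u(3)] C[OF this(3) u(4)] BCw[OF uT(3)] pos
      show False by linarith
    qed
    show "\<not> (B (T + t) \<and> B (T + (t + 1)) \<and> C (T + (t + 2)) \<and> C (T + (t + 3)))"
    proof
      assume "B (T + t) \<and> B (T + (t + 1)) \<and> C (T + (t + 2)) \<and> C (T + (t + 3))"
      then have "B u" "B (Suc u)" "C (Suc (Suc u))" "C (Suc (Suc (Suc u)))" unfolding eqs by blast+
      from B[OF this(1) u(2)] B[OF this(2) u(3)] C[OF this(3) u(4)] C[OF this(4) u(5)] BCw[OF uT(4)] pos
      show False by linarith
    qed
    show "\<not> (B (T + t) \<and> B (T + (t + 1)) \<and> C (T + (t + 2)) \<and> B (T + (t + 3)) \<and> B (T + (t + 4)) \<and> C (T + (t + 5)))"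
    proof
      assume "B (T + t) \<and> B (T + (t + 1)) \<and> C (T + (t + 2)) \<and> B (T + (t + 3)) \<and> B (T + (t + 4)) \<and> C (T + (t + 5))"
      then have "B u" "B (Suc u)" "C (Suc (Suc u))" "B (Suc (Suc (Suc u)))" "B (Suc (Suc (Suc (Suc u))))" "C (Suc (Suc (Suc (Suc (Suc u)))))" unfolding eqs by blast+
      from B[OF this(1) u(2)] B[OF this(2) u(3)] C[OF this(3) u(4)] B[OF this(4) u(5)] B[OF this(5) u(6)] C[OF this(6) u(7)] BCw[OF uT(6)] pos
      show False by linarith
    qed
  qed
  then obtain s where s: "\<And>n. C (T + s + 4 * n)" "\<And>n. B (T + s + 4 * n + 1)"
    "\<And>n. B (T + s + 4 * n + 2)" "\<And>n. B (T + s + 4 * n + 3)"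
    by (auto simp: add.assoc)
  define p q v where "p n = P (T + s + 4 * n)" and "q n = Q (T + s + 4 * n)"
    and "v n = w (T + s + 4 * n)" for n
  \<comment> \<open>After \<open>cbb\<close> the triple is
    \<open>(2p + 3q, p + 2q, v + p + 2q)\<close>; the inequality is the second one of the final
    \<open>b\<close> from there.\<close>
  have pqv: "p (Suc n) = 3 * p n + 5 * q n \<and> q (Suc n) = 2 * p n + 3 * q n \<and>
      v (Suc n) = v n + 2 * p n + 4 * q n \<and> \<kappa> * (v n + 4 * p n + 7 * q n) - K \<le> 3 * p n + 5 * q n" for n
  proof -
    define u where "u = T + s + 4 * n"
    have u: "u \<ge> t1" "Suc u \<ge> t1" "Suc (Suc u) \<ge> t1" "Suc (Suc (Suc u)) \<ge> t1"
      by (auto simp: u_def T_def)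
    have CB: "C u" "B (Suc u)" "B (Suc (Suc u))" "B (Suc (Suc (Suc u)))"
      using s[of n] by (auto simp: u_def numeral_eq_Suc)
    let ?u3 = "Suc (Suc (Suc u))"
    have "\<kappa> * (w ?u3 + P ?u3 + Q ?u3) - K \<le> P ?u3 + Q ?u3"
      using CB(4) by (simp add: B_def mdefs)
    moreover have "T + s + 4 * Suc n = Suc ?u3" by (simp add: u_def)
    then have "p (Suc n) = P (Suc ?u3)" "q (Suc n) = Q (Suc ?u3)" "v (Suc n) = w (Suc ?u3)"
      "p n = P u" "q n = Q u" "v n = w u"
      by (simp_all only: p_def q_def v_def u_def)
    ultimately show ?thesis
      using C(1-3)[OF CB(1) u(1)] B(1-3)[OF CB(2) u(2)] B(1-3)[OF CB(3) u(3)] B(1-3)[OF CB(4) u(4)]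
      by (simp add: algebra_simps)
  qed
  \<comment> \<open>Along \<open>cbbb\<close> the form \<open>2p\<^sup>2 - 5q\<^sup>2\<close> changes sign and \<open>3v - 2p - q\<close> is invariant,
    so that \<open>p / q\<close> tends to \<open>sqrt 10 / 2\<close> and \<open>v\<close> is \<open>(2p + q) / 3\<close> up to a constant.\<close>
  define E where "E = \<bar>2 * (p 0)\<^sup>2 - 5 * (q 0)\<^sup>2\<bar>"
  have E: "\<bar>2 * (p n)\<^sup>2 - 5 * (q n)\<^sup>2\<bar> = E" for n
  proof (induction n)
    case (Suc n)
    have "2 * (p (Suc n))\<^sup>2 - 5 * (q (Suc n))\<^sup>2 = - (2 * (p n)\<^sup>2 - 5 * (q n)\<^sup>2)"
      using pqv[of n] by (simp add: power2_eq_square algebra_simps)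
    then show ?case using Suc by simp
  qed (simp add: E_def)
  define F where "F = 3 * v 0 - 2 * p 0 - q 0"
  have F: "3 * v n = 2 * p n + q n + F" for n
  proof (induction n)
    case (Suc n)
    then show ?case using pqv[of n] by simp
  qed (simp add: F_def)
  have p1: "p n \<ge> 1" "q n \<ge> 1" for n using P Q by (auto simp: p_def q_def)
  \<comment> \<open>With \<open>3v\<close> eliminated by \<open>F\<close>, the inequality in
    \<open>pqv\<close> compares \<open>9p + 15q\<close> with \<open>14p + 22q\<close>, whose ratio
    at \<open>p / q = sqrt 10 / 2\<close> is exactly \<open>sqrt 10 - 5 / 2\<close>. The right side
    does not depend on \<open>n\<close>.\<close>
  have bound: "(\<kappa> - (sqrt 10 - 5 / 2)) * (14 * p n + 22 * q n) \<le> 3 * K + \<kappa> * \<bar>F\<bar> + E" for n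
  proof -
    define \<sigma> where "\<sigma> = sqrt 10 / 2"
    have \<sigma>2: "\<sigma> * \<sigma> = 5 / 2" by (simp add: \<sigma>_def)
    have \<sigma>b: "\<sigma> > 1581 / 1000" "\<sigma> < 1582 / 1000"
      using \<open>sqrt 10 > 3162 / 1000\<close> real_less_lsqrt[of "3164 / 1000" 10]
      by (auto simp: \<sigma>_def power2_eq_square)
    have "\<kappa> * (3 * v n + 12 * p n + 21 * q n) - 3 * K \<le> 9 * p n + 15 * q n"
      using pqv[of n] by (simp add: algebra_simps)
    moreover have "3 * v n + 12 * p n + 21 * q n = 14 * p n + 22 * q n + F"
      using F[of n] by simp
    ultimately have 1: "\<kappa> * (14 * p n + 22 * q n + F) - 3 * K \<le> 9 * p n + 15 * q n"
      by simp
    have "(p n - \<sigma> * q n) * (p n + \<sigma> * q n) = (p n)\<^sup>2 - (\<sigma> * \<sigma>) * (q n)\<^sup>2"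
      by (simp add: power2_eq_square algebra_simps)
    also have "\<dots> = (2 * (p n)\<^sup>2 - 5 * (q n)\<^sup>2) / 2" by (simp add: \<sigma>2)
    finally have "\<bar>p n - \<sigma> * q n\<bar> * \<bar>p n + \<sigma> * q n\<bar> = E / 2"
      using E[of n] by (simp add: abs_mult[symmetric])
    moreover have "\<bar>p n + \<sigma> * q n\<bar> \<ge> 1"
    proof -
      have "0 \<le> \<sigma> * q n" using \<sigma>b p1[of n] by (intro mult_nonneg_nonneg) auto
      then show ?thesis using p1[of n] by simp
    qed
    then have "\<bar>p n - \<sigma> * q n\<bar> * 1 \<le> \<bar>p n - \<sigma> * q n\<bar> * \<bar>p n + \<sigma> * q n\<bar>"
      by (intro mult_left_mono) auto
    ultimately have "\<bar>p n - \<sigma> * q n\<bar> \<le> E / 2" by simp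
    then have 2: "\<bar>p n - \<sigma> * q n\<bar> \<le> E" by linarith
    \<comment> \<open>The coefficient of \<open>q n\<close> vanishes as
      \<open>\<sigma> * \<sigma> = 5 / 2\<close>, leaving a multiple of the bounded difference
      \<open>p n - \<sigma> * q n\<close>.\<close>
    have "9 * p n + 15 * q n - (2 * \<sigma> - 5 / 2) * (14 * p n + 22 * q n) =
        (44 - 28 * \<sigma>) * (p n - \<sigma> * q n) + (70 - 28 * (\<sigma> * \<sigma>)) * q n"
      by (simp add: algebra_simps)
    also have "\<dots> = (44 - 28 * \<sigma>) * (p n - \<sigma> * q n)" by (simp add: \<sigma>2)
    also have "\<dots> \<le> \<bar>44 - 28 * \<sigma>\<bar> * \<bar>p n - \<sigma> * q n\<bar>" by (simp add: abs_mult[symmetric])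
    also have "\<dots> \<le> 1 * \<bar>p n - \<sigma> * q n\<bar>" using \<sigma>b by (intro mult_right_mono) auto
    finally have 3: "9 * p n + 15 * q n - (sqrt 10 - 5 / 2) * (14 * p n + 22 * q n) \<le> E"
      using 2 by (simp add: \<sigma>_def)
    have "\<kappa> * F \<ge> - (\<kappa> * \<bar>F\<bar>)"
      using mult_left_mono[of "- \<bar>F\<bar>" F \<kappa>] \<kappa>1 by simp
    then show ?thesis using 1 3 by (simp add: algebra_simps)
  qed
  have "P (T + s + 4 * n) + Q (T + s + 4 * n) \<ge> n" for n
    using grow[of "T + s + 4 * n"] by simp
  then have big: "14 * p n + 22 * q n \<ge> real n" for n
    using p1[of n] unfolding p_def q_def by (smt (verit))
  obtain n :: nat where n: "real n > (3 * K + \<kappa> * \<bar>F\<bar> + E) / (\<kappa> - (sqrt 10 - 5 / 2))"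
    using reals_Archimedean2 by blast
  then have "3 * K + \<kappa> * \<bar>F\<bar> + E < real n * (\<kappa> - (sqrt 10 - 5 / 2))"
    using \<kappa> by (simp add: divide_less_eq)
  also have "\<dots> \<le> (14 * p n + 22 * q n) * (\<kappa> - (sqrt 10 - 5 / 2))"
    using big[of n] \<kappa> by (intro mult_right_mono) auto
  finally show False using bound[of n] by (simp add: mult.commute)
qed

section \<open>The bound\<close>

context recurrent_unit_growth
begin

text \<open>\<open>b'\<close> stays free because the invariant difference \<open>b - P - Q\<close>
  in \<open>stages\<close> determines it.\<close>

definition stage_succ :: "nat \<times> nat \<times> nat \<times> nat \<Rightarrow> nat \<times> nat \<times> nat \<times> nat \<Rightarrow> bool" where
  "stage_succ = (\<lambda>(b, P, Q, w) (b', P', Q', w').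
      P' = P \<and> Q' = P + Q \<and> w' = w \<and> agree x (w + b) 0 P \<or>
      P' = P + Q \<and> Q' = P \<and> w' = w + Q \<and> agree x b w (w + Q) \<and> agree x (w + b) 0 (P + Q) \<or>
      P' = P + Q \<and> Q' = Q \<and> w' = w \<and> agree x b w (w + Q) \<or>
      w = 0 \<and> P' = P + Q \<and> Q' = Q \<and> w' = P)"

text \<open>Dependent choice along \<open>stage_step\<close>; every alternative increases
  \<open>b\<close> by the same amount as \<open>P + Q\<close>.\<close>

lemma stages:
  "\<exists>b P Q w. \<exists>C :: int. \<forall>t. stage (b t) (P t) (Q t) (w t) \<and>
     int (b t) = int (P t) + int (Q t) + C \<and>
     stage_succ (b t, P t, Q t, w t) (b (Suc t), P (Suc t), Q (Suc t), w (Suc t))"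
proof -
  obtain b0 P0 Q0 w0 where init: "stage b0 P0 Q0 w0"
    using returns_initial unfolding stage_def by blast
  define C where "C = int b0 - int P0 - int Q0"
  define ok where "ok = (\<lambda>(b, P, Q, w). stage b P Q w \<and> int b = int P + int Q + C)"
  have "\<exists>f. \<forall>t. ok (f t) \<and> stage_succ (f t) (f (Suc t))"
  proof (rule dependent_nat_choice)
    show "\<exists>s. ok s" using init by (intro exI[of _ "(b0, P0, Q0, w0)"]) (simp add: ok_def C_def)
  next
    fix s :: "nat \<times> nat \<times> nat \<times> nat"
    obtain b P Q w where s: "s = (b, P, Q, w)" by (cases s) auto
    assume "ok s"
    then have st: "stage b P Q w" and b: "int b = int P + int Q + C" by (auto simp: s ok_def)
    show "\<exists>s'. ok s' \<and> stage_succ s s'"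
      using stage_step[OF st]
    proof (elim disjE conjE)
      assume "stage (b + P) P (P + Q) w" "agree x (w + b) 0 P"
      then show ?thesis
        using b by (intro exI[of _ "(b + P, P, P + Q, w)"]) (simp add: s ok_def stage_succ_def)
    next
      assume "stage (b + P) (P + Q) P (w + Q)" "agree x b w (w + Q)" "agree x (w + b) 0 (P + Q)"
      then show ?thesis
        using b by (intro exI[of _ "(b + P, P + Q, P, w + Q)"]) (simp add: s ok_def stage_succ_def)
    next
      assume "stage (b + Q) (P + Q) Q w" "agree x b w (w + Q)"
      then show ?thesis
        using b by (intro exI[of _ "(b + Q, P + Q, Q, w)"]) (simp add: s ok_def stage_succ_def)
    next
      assume "w = 0" "stage (b + Q) (P + Q) Q P"
      then show ?thesis
        using b by (intro exI[of _ "(b + Q, P + Q, Q, P)"]) (simp add: s ok_def stage_succ_def)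
    qed
  qed
  then obtain f where f: "\<forall>t. ok (f t) \<and> stage_succ (f t) (f (Suc t))" ..
  define b P Q w where "b t = fst (f t)" and "P t = fst (snd (f t))"
    and "Q t = fst (snd (snd (f t)))" and "w t = snd (snd (snd (f t)))" for t
  have "f t = (b t, P t, Q t, w t)" for t by (simp add: b_def P_def Q_def w_def)
  with f have "\<forall>t. stage (b t) (P t) (Q t) (w t) \<and> int (b t) = int (P t) + int (Q t) + C \<and>
     stage_succ (b t, P t, Q t, w t) (b (Suc t), P (Suc t), Q (Suc t), w (Suc t))"
    by (simp add: ok_def)
  then show ?thesis by blast
qed

text \<open>Without such repetitions the agreements recorded in \<open>stage_succ\<close> yield the
  inequalities of the moves, which \<open>no_itinerary\<close> excludes.\<close>

lemma close_repetition:
  assumes "\<kappa> > sqrt 10 - 5 / 2"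
  shows "\<exists>i j n. i < j \<and> agree x n i j \<and> n \<ge> N \<and> real j < \<kappa> * real n - K"
proof (rule ccontr)
  assume neg: "\<not> ?thesis"
  have "sqrt 10 > 5 / 2" by (rule real_less_rsqrt) (simp add: power2_eq_square)
  then have \<kappa>: "\<kappa> > 0" using assms by simp
  obtain b P Q w :: "nat \<Rightarrow> nat" and C :: int where
    stages: "\<forall>t. stage (b t) (P t) (Q t) (w t) \<and> int (b t) = int (P t) + int (Q t) + C \<and>
      stage_succ (b t, P t, Q t, w t) (b (Suc t), P (Suc t), Q (Suc t), w (Suc t))"
    using stages by blast
  then have st: "stage (b t) (P t) (Q t) (w t)" and b: "int (b t) = int (P t) + int (Q t) + C"
    and step: "stage_succ (b t, P t, Q t, w t) (b (Suc t), P (Suc t), Q (Suc t), w (Suc t))" for t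
    by blast+
  \<comment> \<open>\<open>K'\<close> absorbs the given \<open>K\<close>, the constant
    \<open>C\<close> between \<open>b\<close> and \<open>P + Q\<close>, and, through
    \<open>\<kappa> * real N\<close>, the lengths below \<open>N\<close>, for which the bound
    becomes trivial.\<close>
  define K' where "K' = \<bar>K\<bar> + \<kappa> * \<bar>real_of_int C\<bar> + \<kappa> * real N"
  have far: "\<kappa> * (real n - C) - K' \<le> real j" if "i < j" "agree x n i j" for i j n
  proof -
    have C: "\<kappa> * - C \<le> \<kappa> * \<bar>real_of_int C\<bar>" using \<kappa> by (intro mult_left_mono) auto
    show ?thesis
    proof (cases "n \<ge> N")
      case True
      then have "\<not> real j < \<kappa> * real n - K" using neg that by blast
      moreover have "0 \<le> \<kappa> * real N" using \<kappa> by simp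
      ultimately show ?thesis using C unfolding K'_def by (simp add: algebra_simps)
    next
      case False
      then have "\<kappa> * real n \<le> \<kappa> * real N" using \<kappa> by (intro mult_left_mono) auto
      then show ?thesis using C unfolding K'_def by (simp add: algebra_simps)
    qed
  qed
  have pos: "0 < P t" "0 < Q t" "w t \<le> P t" for t using stage_pos[OF st] by auto
  have bt: "real (b t) - C = real (P t) + real (Q t)" for t
    using arg_cong[OF b[of t], of real_of_int] by simp
  show False
  proof (rule no_itinerary[OF assms, where P = "\<lambda>t. real (P t)" and Q = "\<lambda>t. real (Q t)"
        and w = "\<lambda>t. real (w t)" and K = K'])
    fix t
    show "real (P t) \<ge> 1" "real (Q t) \<ge> 1" "0 \<le> real (w t)" "real (w t) \<le> real (P t)"
      using pos[of t] by auto
    have far1: "\<kappa> * (real (w t) + real (P t) + real (Q t)) - K' \<le> real j"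
      if "0 < j" "agree x (w t + b t) 0 j" for j
      using far[OF that] bt[of t] by (simp add: algebra_simps)
    have far2: "\<kappa> * (real (P t) + real (Q t)) - K' \<le> real (w t) + real (Q t)"
      if "agree x (b t) (w t) (w t + Q t)"
      using far[OF _ that] bt[of t] pos(2)[of t] by simp
    show "move_a \<kappa> K' (real (P t), real (Q t), real (w t)) (real (P (Suc t)), real (Q (Suc t)), real (w (Suc t))) \<or>
      move_b \<kappa> K' (real (P t), real (Q t), real (w t)) (real (P (Suc t)), real (Q (Suc t)), real (w (Suc t))) \<or>
      move_c \<kappa> K' (real (P t), real (Q t), real (w t)) (real (P (Suc t)), real (Q (Suc t)), real (w (Suc t))) \<or>
      real (w t) = 0 \<and> real (P (Suc t)) = real (P t) + real (Q t) \<and> real (Q (Suc t)) = real (Q t) \<and>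
        real (w (Suc t)) = real (P t)"
      using step[of t] unfolding stage_succ_def prod.case
    proof (elim disjE conjE)
      assume "P (Suc t) = P t" "Q (Suc t) = P t + Q t" "w (Suc t) = w t"
        "agree x (w t + b t) 0 (P t)"
      then show ?thesis using far1[of "P t"] pos[of t] by (simp add: move_a_def)
    next
      assume "P (Suc t) = P t + Q t" "Q (Suc t) = P t" "w (Suc t) = w t + Q t"
        "agree x (b t) (w t) (w t + Q t)" "agree x (w t + b t) 0 (P t + Q t)"
      then show ?thesis using far1[of "P t + Q t"] far2 pos[of t] by (simp add: move_b_def)
    next
      assume "P (Suc t) = P t + Q t" "Q (Suc t) = Q t" "w (Suc t) = w t"
        "agree x (b t) (w t) (w t + Q t)"
      then show ?thesis using far2 by (simp add: move_c_def)
    qed simp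
  qed
qed

end

section \<open>From repetitions in the tail to the exponent of the whole word\<close>

lemma rec_fun_le:
  assumes "i < j" "agree x n i j"
  shows "rec_fun n x \<le> j + n"
  unfolding rec_fun_def
  by (rule Least_le) (use assms in \<open>auto simp: factor_eq_iff\<close>)

theorem theorem3p7:
  fixes s :: "nat \<Rightarrow> 'a"
  assumes "quasi_sturmian s"
  shows "rep s \<le> ereal (sqrt 10 - 3 / 2)"
proof (rule ccontr)
  assume "\<not> ?thesis"
  then have "ereal (sqrt 10 - 3 / 2) < rep s" by simp
  then obtain c where c: "ereal (sqrt 10 - 3 / 2) < ereal c" "ereal c < rep s"
    using ereal_dense2 by blast
  have "eventually (\<lambda>n. ereal c < ereal (real (rec_fun n s) / real n)) sequentially"
    using c(2) unfolding rep_def by (rule less_LiminfD)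
  then obtain N where N: "\<And>n. n \<ge> N \<Longrightarrow> c < real (rec_fun n s) / real n"
    by (auto simp: eventually_sequentially)
  obtain k where ec0: "eventual_complexity s k"
    using assms by (auto simp: quasi_sturmian_def eventual_complexity_def)
  obtain m k' where ec: "eventual_complexity (\<lambda>i. s (m + i)) k'"
    and rec: "\<forall>n i K. \<exists>j\<ge>K. agree (\<lambda>i. s (m + i)) n i j"
    using recurrent_shift_exists[OF ec0] by blast
  obtain n0 where n0: "\<And>n. n \<ge> n0 \<Longrightarrow> int (complexity n (\<lambda>i. s (m + i))) = int n + k'"
    using ec by (auto simp: eventual_complexity_def)
  interpret recurrent_unit_growth "\<lambda>i. s (m + i)" n0
  proof
    show "finite (range (\<lambda>i. s (m + i)))" using ec by (simp add: eventual_complexity_def)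
    show "complexity (Suc n) (\<lambda>i. s (m + i)) = Suc (complexity n (\<lambda>i. s (m + i)))"
      if "n \<ge> n0" for n
      using n0[of n] n0[of "Suc n"] that by simp
    show "\<exists>n. \<not> agree (\<lambda>i. s (m + i)) n i j" if "i < j" for i j
      by (rule not_agree_always[OF ec that])
  qed (rule rec[rule_format])
  \<comment> \<open>\<open>rec_fun\<close> measures the end \<open>j + n\<close> of a repetition and
    \<open>close_repetition\<close> its start \<open>j\<close>, whence the slope
    \<open>c - 1\<close>.\<close>
  have "c - 1 > sqrt 10 - 5 / 2" using c(1) by simp
  \<comment> \<open>\<open>max N 1\<close> keeps \<open>n\<close> positive for the division, and
    \<open>real m\<close> pays for the \<open>m\<close> deleted letters.\<close>
  from close_repetition[OF this, of "max N 1" "real m"] obtain i j n where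
    ij: "i < j" "agree (\<lambda>i. s (m + i)) n i j" "n \<ge> max N 1" "real j < (c - 1) * real n - real m"
    by blast
  have "rec_fun n s \<le> (m + j) + n"
    by (rule rec_fun_le[of "m + i"]) (use ij in \<open>auto simp: agree_shift\<close>)
  moreover have "c * real n < real (rec_fun n s)"
    using N[of n] ij(3) by (simp add: less_divide_eq)
  ultimately show False using ij(4) by (simp add: algebra_simps)
qed

end
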